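(* The continuous limit of the pentagram map $T$ is the equation $$\dot u=w',\qquad \dot w=-\frac{u\,u'}{3}-\frac{u'''}{12}.$$ That is, if $\gamma$ is a non-degenerate curve corresponding to functions $(u,w)$, and $(u_\varepsilon,w_\varepsilon)$ are the functions corresponding to the envelope $\gamma_\varepsilon$ of the chords $(\gamma(x-\varepsilon),\gamma(x+\varepsilon))$, then $u_\varepsilon=u+\varepsilon^2\widetilde u+O(\varepsilon^3)$ and $w_\varepsilon=w+\varepsilon^2\widetilde w+O(\varepsilon^3)$ with $\widetilde u=w'$ and $\widetilde w=-\frac{uu'}{3}-\frac{u'''}{12}$.
   Context: A non-degenerate curve is a smooth parametrized curve $\gamma:\mathbb{R}\to\mathbb{RP}^2$ with $\gamma(x+1)=M(\gamma(x))$ for all $x$, for a fixed projective transformation $M$, such that $\gamma'(x)$ and $\gamma''(x)$ are linearly independent for all $x$. Such a curve has a unique lift $\Gamma:\mathbb{R}\to\mathbb{R}^3$ with $\det(\Gamma(x),\Gamma'(x),\Gamma''(x))=1$ for all $x$, and then $\Gamma'''+u\,\Gamma'+v\,\Gamma=0$ for smooth periodic functions $u,v$. Put $w=v-\frac{u'}{2}$, so that the differential operator $\left(\frac{d}{dx}\right)^3+u\frac{d}{dx}+v$ is written as $\left(\frac{d}{dx}\right)^3+\frac12\left(u\frac{d}{dx}+\frac{d}{dx}u\right)+w$. The pair $(u,w)$ is the pair of functions corresponding to $\gamma$; it determines $\gamma$ up to projective equivalence. For small $\varepsilon>0$, at each $x$ draw the chord $(\gamma(x-\varepsilon),\gamma(x+\varepsilon))$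 (a projective line) and let $\gamma_\varepsilon(x)$ be the envelope of this family of lines, parametrized so that $\gamma_\varepsilon(x)$ is the point of tangency with the chord at $x$. Let $(u_\varepsilon,w_\varepsilon)$ be the functions corresponding to $\gamma_\varepsilon$. The continuous limit of the pentagram map is, by definition, the evolution equation $\dot u=\widetilde u$, $\dot w=\widetilde w$, where $\widetilde u,\widetilde w$ are the coefficients of $\varepsilon^2$ in the expansions of $u_\varepsilon$, $w_\varepsilon$; here the dot is the derivative in time $t$ and the prime is the derivative in $x$. *)

theory Defs
  imports "HOL-Analysis.Analysis"
begin

section \<open>The real projective plane\<close>

typedef rp2 = "{L :: (real^3) set. subspace L \<and> dim L = 1}"
proof
  show "span {axis 1 1 :: real^3} \<in> {L. subspace L \<and> dim L = 1}"
    by (simp add: dim_insert axis_eq_0_iff)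
qed

text \<open>A projective line is represented by the plane through the origin of \<open>\<real>\<^sup>3\<close> which it spans.
  If \<open>p = q\<close>, the following is not a projective line but only the point \<open>p\<close>.\<close>

definition line_through :: "rp2 \<Rightarrow> rp2 \<Rightarrow> (real^3) set" where
  "line_through p q = span (Rep_rp2 p \<union> Rep_rp2 q)"

definition proj_map :: "real^3^3 \<Rightarrow> rp2 \<Rightarrow> rp2" where
  "proj_map M p = Abs_rp2 ((*v) M ` Rep_rp2 p)"

text \<open>The \<open>i\<close>-th standard affine chart identifies the points outside the line \<open>v $ i = 0\<close> with the
  affine plane \<open>v $ i = 1\<close> in \<open>\<real>\<^sup>3\<close>. Thus the first and higher derivatives of a curve read in this
  chart are vectors whose \<open>i\<close>-th coordinate vanishes.\<close>

definition in_chart :: "3 \<Rightarrow> rp2 \<Rightarrow> bool" where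
  "in_chart i p \<longleftrightarrow> (\<exists>v\<in>Rep_rp2 p. v $ i \<noteq> 0)"

definition affine_coord :: "3 \<Rightarrow> rp2 \<Rightarrow> real^3" where
  "affine_coord i p = (THE v. v \<in> Rep_rp2 p \<and> v $ i = 1)"


section \<open>Smooth and non-degenerate curves\<close>

definition vderiv :: "(real \<Rightarrow> 'a::real_normed_vector) \<Rightarrow> real \<Rightarrow> 'a" where
  "vderiv f x = vector_derivative f (at x)"

text \<open>Meant for open \<open>S\<close>.\<close>

definition smooth_on :: "real set \<Rightarrow> (real \<Rightarrow> 'a::real_normed_vector) \<Rightarrow> bool" where
  "smooth_on S f \<longleftrightarrow> (\<forall>n. \<forall>x\<in>S. (vderiv ^^ n) f differentiable (at x))"

definition smooth_curve :: "(real \<Rightarrow> rp2) \<Rightarrow> bool" where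
  "smooth_curve \<gamma> \<longleftrightarrow>
     (\<forall>x i. in_chart i (\<gamma> x) \<longrightarrow>
        (\<exists>S. open S \<and> x \<in> S \<and> (\<forall>y\<in>S. in_chart i (\<gamma> y)) \<and> smooth_on S (\<lambda>y. affine_coord i (\<gamma> y))))"

text \<open>The derivatives of \<open>\<gamma>\<close> are taken in affine charts; linear independence of the first two does
  not depend on the chart.\<close>

definition nondegenerate_curve :: "real^3^3 \<Rightarrow> (real \<Rightarrow> rp2) \<Rightarrow> bool" where
  "nondegenerate_curve M \<gamma> \<longleftrightarrow>
     invertible M \<and>
     smooth_curve \<gamma> \<and>
     (\<forall>x. \<gamma> (x + 1) = proj_map M (\<gamma> x)) \<and>
     (\<forall>x i. in_chart i (\<gamma> x) \<longrightarrow>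
        (let c = (\<lambda>y. affine_coord i (\<gamma> y))
         in \<forall>a b. a *\<^sub>R vderiv c x + b *\<^sub>R (vderiv ^^ 2) c x = 0 \<longrightarrow> a = 0 \<and> b = 0))"


section \<open>The functions corresponding to a non-degenerate curve\<close>

definition unimodular_lift :: "(real \<Rightarrow> rp2) \<Rightarrow> (real \<Rightarrow> real^3) \<Rightarrow> bool" where
  "unimodular_lift \<gamma> \<Gamma> \<longleftrightarrow>
     smooth_on UNIV \<Gamma> \<and>
     (\<forall>x. \<Gamma> x \<in> Rep_rp2 (\<gamma> x)) \<and>
     (\<forall>x. det (vector [\<Gamma> x, vderiv \<Gamma> x, (vderiv ^^ 2) \<Gamma> x] :: real^3^3) = 1)"

definition smooth_periodic :: "(real \<Rightarrow> real) \<Rightarrow> bool" where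
  "smooth_periodic f \<longleftrightarrow> smooth_on UNIV f \<and> (\<forall>x. f (x + 1) = f x)"

definition corresponds :: "(real \<Rightarrow> rp2) \<Rightarrow> (real \<Rightarrow> real) \<Rightarrow> (real \<Rightarrow> real) \<Rightarrow> bool" where
  "corresponds \<gamma> u w \<longleftrightarrow>
     (\<exists>\<Gamma> v. unimodular_lift \<gamma> \<Gamma> \<and> smooth_periodic u \<and> smooth_periodic v \<and>
        (\<forall>x. (vderiv ^^ 3) \<Gamma> x + u x *\<^sub>R vderiv \<Gamma> x + v x *\<^sub>R \<Gamma> x = 0) \<and>
        w = (\<lambda>x. v x - deriv u x / 2))"

definition corr_u :: "(real \<Rightarrow> rp2) \<Rightarrow> real \<Rightarrow> real" where
  "corr_u \<gamma> = (THE u. \<exists>w. corresponds \<gamma> u w)"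

definition corr_w :: "(real \<Rightarrow> rp2) \<Rightarrow> real \<Rightarrow> real" where
  "corr_w \<gamma> = (THE w. \<exists>u. corresponds \<gamma> u w)"


section \<open>Envelopes of chords\<close>

text \<open>An envelope of a family of lines is parametrized by the points of tangency. Tangency means that
  the velocity of \<open>\<delta>\<close> at \<open>x\<close> does not vanish and that the given line is the tangent line; in
  particular the latter passes through \<open>\<delta> x\<close> and is a genuine line.\<close>

definition tangent_at :: "(real^3) set \<Rightarrow> (real \<Rightarrow> rp2) \<Rightarrow> real \<Rightarrow> bool" where
  "tangent_at l \<delta> x \<longleftrightarrow>
     (\<forall>i. in_chart i (\<delta> x) \<longrightarrow>
        (let c = (\<lambda>y. affine_coord i (\<delta> y)) in vderiv c x \<noteq> 0 \<and> l = span {c x, vderiv c x}))"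

definition is_envelope :: "(real \<Rightarrow> (real^3) set) \<Rightarrow> (real \<Rightarrow> rp2) \<Rightarrow> bool" where
  "is_envelope l \<delta> \<longleftrightarrow> smooth_curve \<delta> \<and> (\<forall>x. tangent_at (l x) \<delta> x)"

definition chord :: "(real \<Rightarrow> rp2) \<Rightarrow> real \<Rightarrow> real \<Rightarrow> (real^3) set" where
  "chord \<gamma> \<epsilon> x = line_through (\<gamma> (x - \<epsilon>)) (\<gamma> (x + \<epsilon>))"

definition chord_envelope :: "(real \<Rightarrow> rp2) \<Rightarrow> real \<Rightarrow> real \<Rightarrow> rp2" where
  "chord_envelope \<gamma> \<epsilon> = (THE \<delta>. is_envelope (chord \<gamma> \<epsilon>) \<delta>)"


section \<open>The continuous limit of the pentagram map\<close>

text \<open>\<open>f\<^sub>\<epsilon> = f\<^sub>0 + \<epsilon>\<^sup>2 f\<^sub>2 + O(\<epsilon>\<^sup>3)\<close> as \<open>\<epsilon>\<close> tends to \<open>0\<close> from above, uniformly in the space variable.\<close>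

definition expands2 ::
    "(real \<Rightarrow> real \<Rightarrow> real) \<Rightarrow> (real \<Rightarrow> real) \<Rightarrow> (real \<Rightarrow> real) \<Rightarrow> bool" where
  "expands2 f f0 f2 \<longleftrightarrow>
     (\<exists>C. \<forall>\<^sub>F \<epsilon> in at_right 0. \<forall>x. \<bar>f \<epsilon> x - (f0 x + \<epsilon>\<^sup>2 * f2 x)\<bar> \<le> C * \<epsilon> ^ 3)"

text \<open>The evolution equation \<open>\<partial>u/\<partial>t = ut\<close>, \<open>\<partial>w/\<partial>t = wt\<close> on a set \<open>I\<close> of times, where \<open>ut\<close> and \<open>wt\<close> are
  the coefficients of \<open>\<epsilon>\<^sup>2\<close> at time \<open>t\<close>. The curve \<open>\<gamma> t\<close> is one to which the pair \<open>(u t, w t)\<close>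
  corresponds.\<close>

definition continuous_limit_equation ::
    "real set \<Rightarrow> (real \<Rightarrow> real \<Rightarrow> rp2) \<Rightarrow> (real \<Rightarrow> real \<Rightarrow> real) \<Rightarrow> (real \<Rightarrow> real \<Rightarrow> real) \<Rightarrow> bool" where
  "continuous_limit_equation I \<gamma> u w \<longleftrightarrow>
     (\<forall>t\<in>I. \<exists>ut wt.
        expands2 (\<lambda>\<epsilon>. corr_u (chord_envelope (\<gamma> t) \<epsilon>)) (u t) ut \<and>
        expands2 (\<lambda>\<epsilon>. corr_w (chord_envelope (\<gamma> t) \<epsilon>)) (w t) wt \<and>
        (\<forall>x. ((\<lambda>s. u s x) has_real_derivative ut x) (at t within I) \<and>
             ((\<lambda>s. w s x) has_real_derivative wt x) (at t within I)))"

end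

theory Submission
  imports Defs
begin

text \<open>Fix the unimodular lift \<open>\<Gamma>\<close> of \<open>\<gamma>\<close>. The envelope of the chords is lifted by
  \<open>E = p \<Gamma>(x + \<epsilon>) + q \<Gamma>(x - \<epsilon>)\<close>, where the coefficients \<open>p = det (\<Gamma>(x - \<epsilon>), \<Gamma>'(x - \<epsilon>), \<Gamma>(x + \<epsilon>))\<close>
  and \<open>q = det (\<Gamma>(x + \<epsilon>), \<Gamma>'(x + \<epsilon>), \<Gamma>(x - \<epsilon>))\<close> are forced by the condition that \<open>E'\<close> lies in the
  plane of the chord; both are \<open>2\<epsilon>\<^sup>2 - 2/3 \<epsilon>\<^sup>4 u + O(\<epsilon>\<^sup>5)\<close>. After normalization the lift becomes
  \<open>\<Gamma> + \<epsilon>\<^sup>2 H + O(\<epsilon>\<^sup>3)\<close> with \<open>H = \<Gamma>''/2 + u \<Gamma>/3\<close>, and the coefficients of its differential equation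
  are read off from \<open>H''' + u H' + v H + w' \<Gamma>' + (v''/2 - (u''' + u u')/3) \<Gamma> = 0\<close>.

  All expansions hold on the unit interval together with their derivatives in \<open>x\<close>; as \<open>\<Gamma>\<close> is
  periodic only up to a linear map, uniformity on the line is deduced at the end from the
  periodicity of the resulting scalar functions.\<close>

section \<open>Smooth functions\<close>

text \<open>The functions of the envelope involve up to four derivatives of its unimodular lift, so
  pointwise remainders are not enough: each one is bounded together with its
  \<open>x\<close>-derivatives, and expansions may then be differentiated term by term. As both
  weights of the end points of a chord have order 2 in \<epsilon>, the unnormalized lift is needed
  up to an error of order 5, which leaves order 3 after division. Normalization takes two steps. An
  explicit factor makes the Wronskian 1 + O(\<epsilon>^3); its power -1/3, the exact correction, is
  then 1 + O(\<epsilon>^3) too, so a Lipschitz estimate replaces an expansion of that power. The new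
  coefficients are not found by expanding determinants: the equation with the predicted coefficients
  holds up to O(\<epsilon>^3), and pairing this residue with the lift and its derivatives bounds the
  error of each coefficient. The envelope and its functions are definite descriptions, so the
  expansions presuppose uniqueness of the tangent curve, of the unimodular lift and of the
  pair.\<close>

lemma has_vderiv: "f differentiable (at x) \<Longrightarrow> (f has_vector_derivative vderiv f x) (at x)"
  by (simp add: vderiv_def vector_derivative_works)

lemma vderiv_eqI: "(f has_vector_derivative d) (at x) \<Longrightarrow> vderiv f x = d"
  by (simp add: vderiv_def vector_derivative_at)

lemma deriv_eq_vderiv: "deriv f = vderiv (f :: real \<Rightarrow> real)"
  by (rule ext) (simp add: vderiv_def vector_derivative_def deriv_def has_real_derivative_iff_has_vector_derivative)

lemma vderiv_funpow_Suc: "(vderiv ^^ Suc n) f = (vderiv ^^ n) (vderiv f)"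
  by (simp only: funpow_Suc_right o_apply)

text \<open>Both functions have the same vectors as derivatives at \<open>x\<close>, so the choice
  operator behind \<open>vector_derivative\<close> picks the same one. This also covers points
  without a derivative.\<close>

lemma vderiv_cong:
  assumes "open S" "x \<in> S" "\<And>y. y \<in> S \<Longrightarrow> f y = g y"
  shows "vderiv f x = vderiv g x"
proof -
  have "(f has_vector_derivative d) (at x) = (g has_vector_derivative d) (at x)" for d
    using has_vector_derivative_transform_within_open[OF _ assms(1,2), of f d g]
      has_vector_derivative_transform_within_open[OF _ assms(1,2), of g d f] assms(3) by auto
  thus ?thesis unfolding vderiv_def vector_derivative_def by (rule arg_cong[where f = Eps, OF ext])
qed

lemma vderiv_funpow_cong:
  assumes "open S" "x \<in> S" "\<And>y. y \<in> S \<Longrightarrow> f y = g y"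
  shows "(vderiv ^^ n) f x = (vderiv ^^ n) g x"
  using assms(2)
proof (induction n arbitrary: x)
  case (Suc n)
  show ?case unfolding funpow.simps o_apply
    by (rule vderiv_cong[OF assms(1) Suc.prems]) (rule Suc.IH)
qed (use assms in auto)

text \<open>Supplies the induction parameter that \<open>smooth_on\<close> lacks: in the rules for
  sums and products and in the bootstrap, the derivative is treated with one order less.\<close>

definition differentiable_upto :: "nat \<Rightarrow> real set \<Rightarrow> (real \<Rightarrow> 'a::real_normed_vector) \<Rightarrow> bool" where
  "differentiable_upto n S f \<longleftrightarrow> (\<forall>m<n. \<forall>x\<in>S. (vderiv ^^ m) f differentiable (at x))"

lemma smooth_on_upto: "smooth_on S f \<longleftrightarrow> (\<forall>n. differentiable_upto n S f)"
  by (auto simp: smooth_on_def differentiable_upto_def)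

lemma differentiable_upto_0 [simp]: "differentiable_upto 0 S f"
  by (simp add: differentiable_upto_def)

lemma differentiable_upto_Suc:
  "differentiable_upto (Suc n) S f \<longleftrightarrow> (\<forall>x\<in>S. f differentiable (at x)) \<and> differentiable_upto n S (vderiv f)"
  by (simp only: differentiable_upto_def All_less_Suc2 vderiv_funpow_Suc funpow_0)

lemma differentiable_upto_mono: "differentiable_upto n S f \<Longrightarrow> m \<le> n \<Longrightarrow> differentiable_upto m S f"
  by (simp add: differentiable_upto_def)

lemma differentiable_upto_cong:
  assumes "open S" "\<And>x. x \<in> S \<Longrightarrow> f x = g x" "differentiable_upto n S f"
  shows "differentiable_upto n S g"
  unfolding differentiable_upto_def
proof safe
  fix m x assume m: "m < n" "x \<in> S"
  hence "(vderiv ^^ m) f differentiable (at x)" using assms by (auto simp: differentiable_upto_def)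
  moreover have "(vderiv ^^ m) f y = (vderiv ^^ m) g y" if "y \<in> S" for y
    using vderiv_funpow_cong[OF assms(1) that] assms(2) by blast
  ultimately show "(vderiv ^^ m) g differentiable (at x)"
    unfolding differentiable_def using has_derivative_transform_within_open[OF _ assms(1) m(2)] by blast
qed

lemma smooth_on_cong:
  assumes "open S" "\<And>x. x \<in> S \<Longrightarrow> f x = g x" "smooth_on S f"
  shows "smooth_on S g"
  unfolding smooth_on_upto
proof
  show "differentiable_upto n S g" for n
    using assms by (intro differentiable_upto_cong[OF assms(1,2)]) (auto simp: smooth_on_upto)
qed

lemma smooth_on_subset: "smooth_on T f \<Longrightarrow> S \<subseteq> T \<Longrightarrow> smooth_on S f"
  by (auto simp: smooth_on_def)

lemma smooth_on_UNIV: "smooth_on UNIV f \<Longrightarrow> smooth_on S f"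
  by (rule smooth_on_subset) auto

lemma smooth_on_iff:
  "smooth_on S f \<longleftrightarrow> (\<forall>x\<in>S. f differentiable (at x)) \<and> smooth_on S (vderiv f)"
proof -
  have "(\<forall>n. differentiable_upto n S f) = (\<forall>n. differentiable_upto (Suc n) S f)"
    using differentiable_upto_mono[OF _ le_SucI[OF order_refl]] by blast
  thus ?thesis unfolding smooth_on_upto differentiable_upto_Suc by blast
qed

lemma smooth_on_vderiv: "smooth_on S f \<Longrightarrow> smooth_on S (vderiv f)"
  using smooth_on_iff by blast

lemma smooth_on_vderiv_funpow: "smooth_on S f \<Longrightarrow> smooth_on S ((vderiv ^^ n) f)"
  by (induction n) (auto intro: smooth_on_vderiv)

lemma smooth_on_differentiable: "smooth_on S f \<Longrightarrow> x \<in> S \<Longrightarrow> f differentiable (at x)"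
  using smooth_on_iff by blast

lemma smooth_on_has_vderiv: "smooth_on S f \<Longrightarrow> x \<in> S \<Longrightarrow> (f has_vector_derivative vderiv f x) (at x)"
  by (intro has_vderiv smooth_on_differentiable)

lemma smooth_on_continuous: "smooth_on S f \<Longrightarrow> continuous_on S f"
  by (intro continuous_at_imp_continuous_on ballI differentiable_imp_continuous_within
      smooth_on_differentiable)

lemma vderiv_const [simp]: "vderiv (\<lambda>x. c) = (\<lambda>x. 0)"
  by (rule ext) (rule vderiv_eqI, simp)

lemma vderiv_funpow_0 [simp]: "(vderiv ^^ n) (\<lambda>x. 0) = (\<lambda>x. 0)"
  by (induction n) simp_all

lemma smooth_on_const [simp]: "smooth_on S (\<lambda>x. c)"
proof -
  have "(vderiv ^^ n) (\<lambda>x. c) differentiable (at x)" for n x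
    by (cases n) (simp_all add: vderiv_funpow_Suc del: funpow.simps)
  thus ?thesis by (simp add: smooth_on_def)
qed

lemma vderiv_add:
  "f differentiable (at x) \<Longrightarrow> g differentiable (at x) \<Longrightarrow>
    vderiv (\<lambda>x. f x + g x) x = vderiv f x + vderiv g x"
  by (intro vderiv_eqI has_vector_derivative_add has_vderiv)

lemma differentiable_upto_add:
  assumes "open S" "differentiable_upto n S f" "differentiable_upto n S g"
  shows "differentiable_upto n S (\<lambda>x. f x + g x)"
  using assms(2,3)
proof (induction n arbitrary: f g)
  case (Suc n)
  show ?case unfolding differentiable_upto_Suc
  proof (intro conjI ballI)
    show "(\<lambda>x. f x + g x) differentiable (at x)" if "x \<in> S" for x
      using Suc.prems that by (intro differentiable_add) (auto simp: differentiable_upto_Suc)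
    show "differentiable_upto n S (vderiv (\<lambda>x. f x + g x))"
    proof (rule differentiable_upto_cong[OF assms(1)])
      show "differentiable_upto n S (\<lambda>x. vderiv f x + vderiv g x)"
        using Suc.prems by (intro Suc.IH) (auto simp: differentiable_upto_Suc)
      show "vderiv f x + vderiv g x = vderiv (\<lambda>x. f x + g x) x" if "x \<in> S" for x
        using Suc.prems that by (intro vderiv_add[symmetric]) (auto simp: differentiable_upto_Suc)
    qed
  qed
qed simp

lemma smooth_on_add:
  "open S \<Longrightarrow> smooth_on S f \<Longrightarrow> smooth_on S g \<Longrightarrow> smooth_on S (\<lambda>x. f x + g x)"
  by (simp add: smooth_on_upto differentiable_upto_add)

context bounded_bilinear
begin

lemma vderiv_prod:
  "f differentiable (at x) \<Longrightarrow> g differentiable (at x) \<Longrightarrow>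
    vderiv (\<lambda>x. prod (f x) (g x)) x = prod (f x) (vderiv g x) + prod (vderiv f x) (g x)"
  by (intro vderiv_eqI has_vector_derivative has_vderiv)

text \<open>In each product of the Leibniz rule one factor has lost an order and the other is
  weakened to match, so the induction generalizes over both factors.\<close>

lemma differentiable_upto_prod:
  assumes "open S" "differentiable_upto n S f" "differentiable_upto n S g"
  shows "differentiable_upto n S (\<lambda>x. prod (f x) (g x))"
  using assms(2,3)
proof (induction n arbitrary: f g)
  case (Suc n)
  show ?case unfolding differentiable_upto_Suc
  proof (intro conjI ballI)
    show "(\<lambda>x. prod (f x) (g x)) differentiable (at x)" if "x \<in> S" for x
      using Suc.prems that
      by (intro differentiableI_vector[OF has_vector_derivative[OF has_vderiv has_vderiv]])
        (auto simp: differentiable_upto_Suc)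
    have "differentiable_upto n S f" "differentiable_upto n S g"
      using Suc.prems by (auto intro: differentiable_upto_mono[OF _ le_SucI[OF order_refl]])
    hence "differentiable_upto n S (\<lambda>x. prod (f x) (vderiv g x) + prod (vderiv f x) (g x))"
      using Suc.prems assms(1)
      by (intro differentiable_upto_add Suc.IH) (auto simp: differentiable_upto_Suc)
    thus "differentiable_upto n S (vderiv (\<lambda>x. prod (f x) (g x)))"
      by (rule differentiable_upto_cong[OF assms(1), rotated])
        (use Suc.prems in \<open>auto simp: differentiable_upto_Suc vderiv_prod\<close>)
  qed
qed simp

lemma smooth_on_prod:
  "open S \<Longrightarrow> smooth_on S f \<Longrightarrow> smooth_on S g \<Longrightarrow> smooth_on S (\<lambda>x. prod (f x) (g x))"
  by (simp add: smooth_on_upto differentiable_upto_prod)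

end

lemmas smooth_on_scaleR = bounded_bilinear.smooth_on_prod[OF bounded_bilinear_scaleR]
lemmas smooth_on_mult = bounded_bilinear.smooth_on_prod[OF bounded_bilinear_mult]
lemmas smooth_on_inner = bounded_bilinear.smooth_on_prod[OF bounded_bilinear_inner]

lemmas vderiv_scaleR = bounded_bilinear.vderiv_prod[OF bounded_bilinear_scaleR]

lemma smooth_on_scaleR_const: "open S \<Longrightarrow> smooth_on S f \<Longrightarrow> smooth_on S (\<lambda>x. c *\<^sub>R f x)"
  by (intro smooth_on_scaleR) auto

lemma smooth_on_minus: "open S \<Longrightarrow> smooth_on S f \<Longrightarrow> smooth_on S (\<lambda>x. - f x)"
  using smooth_on_scaleR_const[of S f "-1"] by simp

lemma smooth_on_diff:
  "open S \<Longrightarrow> smooth_on S f \<Longrightarrow> smooth_on S g \<Longrightarrow> smooth_on S (\<lambda>x. f x - g x)"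
  using smooth_on_add[of S f "\<lambda>x. - g x"] smooth_on_minus by fastforce

lemma smooth_on_divide_const:
  "open S \<Longrightarrow> smooth_on S f \<Longrightarrow> smooth_on S (\<lambda>x. f x / c :: real)"
  unfolding divide_inverse by (intro smooth_on_mult) auto

lemma smooth_on_power: "open S \<Longrightarrow> smooth_on S f \<Longrightarrow> smooth_on S (\<lambda>x. f x ^ m :: real)"
  by (induction m) (auto intro: smooth_on_mult)

lemma smooth_on_sum:
  assumes "open S" "\<And>i. i \<in> I \<Longrightarrow> smooth_on S (f i)"
  shows "smooth_on S (\<lambda>x. \<Sum>i\<in>I. f i x)"
  using assms(2) by (induction I rule: infinite_finite_induct) (auto intro: smooth_on_add[OF assms(1)])

lemma vderiv_scaleR_const:
  "f differentiable (at x) \<Longrightarrow> vderiv (\<lambda>x. c *\<^sub>R f x) x = c *\<^sub>R vderiv f x"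
  by (simp add: vderiv_scaleR)

lemma vderiv_minus: "f differentiable (at x) \<Longrightarrow> vderiv (\<lambda>x. - f x) x = - vderiv f x"
  using vderiv_scaleR_const[of f x "-1"] by simp

lemma vderiv_diff:
  "f differentiable (at x) \<Longrightarrow> g differentiable (at x) \<Longrightarrow>
    vderiv (\<lambda>x. f x - g x) x = vderiv f x - vderiv g x"
  by (intro vderiv_eqI has_vector_derivative_diff has_vderiv)

lemma vderiv_sum:
  assumes "\<And>i. i \<in> I \<Longrightarrow> f i differentiable (at x)"
  shows "vderiv (\<lambda>x. \<Sum>i\<in>I. f i x) x = (\<Sum>i\<in>I. vderiv (f i) x)"
  using assms by (intro vderiv_eqI has_vector_derivative_sum has_vderiv)

lemma vderiv_funpow_add:
  assumes "smooth_on UNIV f" "smooth_on UNIV g"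
  shows "(vderiv ^^ n) (\<lambda>x. f x + g x) = (\<lambda>x. (vderiv ^^ n) f x + (vderiv ^^ n) g x)"
  using assms
proof (induction n arbitrary: f g)
  case (Suc n)
  have "vderiv (\<lambda>x. f x + g x) = (\<lambda>x. vderiv f x + vderiv g x)"
    using Suc.prems by (auto intro!: ext vderiv_add smooth_on_differentiable)
  thus ?case using Suc by (simp add: vderiv_funpow_Suc smooth_on_vderiv del: funpow.simps)
qed simp

lemma vderiv_funpow_scaleR_const:
  assumes "smooth_on UNIV f"
  shows "(vderiv ^^ n) (\<lambda>x. c *\<^sub>R f x) = (\<lambda>x. c *\<^sub>R (vderiv ^^ n) f x)"
  using assms
proof (induction n arbitrary: f)
  case (Suc n)
  have "vderiv (\<lambda>x. c *\<^sub>R f x) = (\<lambda>x. c *\<^sub>R vderiv f x)"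
    using Suc.prems by (auto intro!: ext vderiv_scaleR_const smooth_on_differentiable)
  thus ?case using Suc by (simp add: vderiv_funpow_Suc smooth_on_vderiv del: funpow.simps)
qed simp

section \<open>Translations of the argument and linear images\<close>

lemma has_vector_derivative_shift:
  assumes "(f has_vector_derivative d) (at (x + a))"
  shows "((\<lambda>x. f (x + a)) has_vector_derivative d) (at x)"
proof -
  have "((\<lambda>x. x + a) has_real_derivative 1) (at x)" by (auto intro!: derivative_eq_intros)
  from vector_diff_chain_at[OF this[unfolded has_real_derivative_iff_has_vector_derivative] assms]
  show ?thesis by (simp add: o_def)
qed

lemma differentiable_shift:
  "f differentiable (at (x + a)) \<Longrightarrow> (\<lambda>x. f (x + a)) differentiable (at (x::real))"
  using has_vector_derivative_shift[OF has_vderiv] differentiableI_vector by blast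

text \<open>Translating back gives the converse of \<open>has_vector_derivative_shift\<close>, so no
  differentiability is assumed.\<close>

lemma vderiv_shift: "vderiv (\<lambda>x. f (x + a)) x = vderiv f (x + a)"
proof -
  have "((\<lambda>x. f (x + a)) has_vector_derivative d) (at x) \<longleftrightarrow> (f has_vector_derivative d) (at (x + a))" for d
    using has_vector_derivative_shift[of f d x a]
      has_vector_derivative_shift[of "\<lambda>x. f (x + a)" d "x + a" "-a"] by auto
  thus ?thesis by (simp add: vderiv_def vector_derivative_def)
qed

lemma vderiv_funpow_shift: "(vderiv ^^ n) (\<lambda>x. f (x + a)) = (\<lambda>x. (vderiv ^^ n) f (x + a))"
proof (induction n)
  case (Suc n)
  then show ?case by (simp add: vderiv_shift[abs_def])
qed simp

lemma smooth_on_shift: "smooth_on UNIV f \<Longrightarrow> smooth_on UNIV (\<lambda>x. f (x + a))"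
  by (simp add: smooth_on_def vderiv_funpow_shift differentiable_shift)

lemma vderiv_linear:
  assumes "bounded_linear h" "f differentiable (at x)"
  shows "vderiv (\<lambda>x. h (f x)) x = h (vderiv f x)"
  by (intro vderiv_eqI bounded_linear.has_vector_derivative[OF assms(1)] has_vderiv assms(2))

text \<open>Reciprocals and real powers of smooth functions satisfy an equation of this kind, which
  gives their smoothness by bootstrapping.\<close>

lemma smooth_on_bootstrap:
  fixes f :: "real \<Rightarrow> real"
  assumes "open S" "smooth_on S h"
    and "\<And>x. x \<in> S \<Longrightarrow> (f has_vector_derivative f x ^ m * h x) (at x)"
  shows "smooth_on S f"
proof -
  have "differentiable_upto n S f" for n
  proof (induction n)
    case (Suc n)
    have pow: "differentiable_upto n S (\<lambda>x. f x ^ j)" for j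
    proof (induction j)
      case 0
      have "differentiable_upto n S (\<lambda>x. 1 :: real)"
        using smooth_on_const[of S "1::real"] unfolding smooth_on_upto by blast
      then show ?case by simp
    next
      case (Suc j)
      then show ?case using \<open>differentiable_upto n S f\<close>
        by (simp add: bounded_bilinear.differentiable_upto_prod[OF bounded_bilinear_mult assms(1)])
    qed
    have "differentiable_upto n S (\<lambda>x. f x ^ m * h x)"
      using pow assms by (intro bounded_bilinear.differentiable_upto_prod[OF bounded_bilinear_mult])
        (auto simp: smooth_on_upto)
    moreover have "f x ^ m * h x = vderiv f x" if "x \<in> S" for x
      using vderiv_eqI[OF assms(3)[OF that]] by simp
    ultimately have "differentiable_upto n S (vderiv f)"
      by (intro differentiable_upto_cong[OF assms(1), of "\<lambda>x. f x ^ m * h x" "vderiv f"])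
    moreover have "\<forall>x\<in>S. f differentiable (at x)"
      by (intro ballI differentiableI_vector[OF assms(3)])
    ultimately show ?case by (simp add: differentiable_upto_Suc)
  qed simp
  thus ?thesis by (simp add: smooth_on_upto)
qed

lemma smooth_on_inverse:
  fixes f :: "real \<Rightarrow> real"
  assumes "open S" "smooth_on S f" "\<And>x. x \<in> S \<Longrightarrow> f x \<noteq> 0"
  shows "smooth_on S (\<lambda>x. inverse (f x))"
proof (rule smooth_on_bootstrap[where m = 2 and h = "\<lambda>x. - vderiv f x"])
  show "smooth_on S (\<lambda>x. - vderiv f x)" using assms by (intro smooth_on_minus smooth_on_vderiv)
next
  fix x assume "x \<in> S"
  hence "(f has_real_derivative vderiv f x) (at x)"
    using smooth_on_has_vderiv[OF assms(2)] by (simp add: has_real_derivative_iff_has_vector_derivative)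
  hence "((\<lambda>x. inverse (f x)) has_real_derivative (inverse (f x))\<^sup>2 * - vderiv f x) (at x)"
    using assms(3)[OF \<open>x \<in> S\<close>] by (auto intro!: derivative_eq_intros simp: power2_eq_square)
  thus "((\<lambda>x. inverse (f x)) has_vector_derivative (inverse (f x))\<^sup>2 * - vderiv f x) (at x)"
    by (simp add: has_real_derivative_iff_has_vector_derivative)
qed fact

text \<open>The exponent -4/3 of the derivative is written as a fourth power of the function itself,
  the form that \<open>smooth_on_bootstrap\<close> asks for.\<close>

lemma has_vderiv_inverse_cbrt:
  fixes f :: "real \<Rightarrow> real"
  assumes "f differentiable (at x)" "f x > 0"
  shows "((\<lambda>x. f x powr (- 1/3)) has_vector_derivative
           (f x powr (- 1/3)) ^ 4 * (- vderiv f x / 3)) (at x)"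
proof -
  have "(f has_real_derivative vderiv f x) (at x)"
    using has_vderiv[OF assms(1)] by (simp add: has_real_derivative_iff_has_vector_derivative)
  hence "((\<lambda>x. f x powr (- 1/3)) has_real_derivative (- 1/3) * f x powr (- 1/3 - 1) * vderiv f x) (at x)"
    using assms(2) by (auto intro!: derivative_eq_intros)
  moreover have "(f x powr (- 1/3)) ^ 4 = f x powr (- 1/3 - 1)"
    using assms(2) by (simp add: powr_power)
  ultimately show ?thesis by (simp add: has_real_derivative_iff_has_vector_derivative)
qed

lemma inverse_cbrt_cube: "x > 0 \<Longrightarrow> (x powr (- 1/3)) ^ 3 * x = (1::real)"
  using powr_add[of x "-1" 1] by (simp add: powr_power)

lemma smooth_on_inverse_cbrt:
  fixes f :: "real \<Rightarrow> real"
  assumes "open S" "smooth_on S f" "\<And>x. x \<in> S \<Longrightarrow> f x > 0"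
  shows "smooth_on S (\<lambda>x. f x powr (- 1/3))"
proof (rule smooth_on_bootstrap[where m = 4 and h = "\<lambda>x. - vderiv f x / 3"])
  show "smooth_on S (\<lambda>x. - vderiv f x / 3)"
    using assms by (intro smooth_on_minus smooth_on_vderiv smooth_on_divide_const)
next
  show "((\<lambda>x. f x powr (- 1/3)) has_vector_derivative
           (f x powr (- 1/3)) ^ 4 * (- vderiv f x / 3)) (at x)" if "x \<in> S" for x
    using that assms by (intro has_vderiv_inverse_cbrt smooth_on_differentiable[OF assms(2)])
qed fact

section \<open>Triple products and Wronskians\<close>

definition triple :: "real^3 \<Rightarrow> real^3 \<Rightarrow> real^3 \<Rightarrow> real" where
  "triple a b c = det (vector [a, b, c])"

text \<open>In this form algebraic identities reduce to \<open>cross3_simps\<close>, and the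
  calculus reduces to the bilinear maps \<open>inner\<close> and \<open>cross3\<close>.\<close>

lemma triple_cross: "triple a b c = a \<bullet> (cross3 b c)"
  by (simp add: triple_def dot_cross_det)

lemma triple_simps [simp]:
  "triple (a + a') b c = triple a b c + triple a' b c"
  "triple a (b + b') c = triple a b c + triple a b' c"
  "triple a b (c + c') = triple a b c + triple a b c'"
  "triple (a - a') b c = triple a b c - triple a' b c"
  "triple a (b - b') c = triple a b c - triple a b' c"
  "triple a b (c - c') = triple a b c - triple a b c'"
  "triple (- a) b c = - triple a b c"
  "triple a (- b) c = - triple a b c"
  "triple a b (- c) = - triple a b c"
  "triple (r *\<^sub>R a) b c = r * triple a b c"
  "triple a (r *\<^sub>R b) c = r * triple a b c"
  "triple a b (r *\<^sub>R c) = r * triple a b c"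
  "triple 0 b c = 0" "triple a 0 c = 0" "triple a b 0 = 0"
  "triple a a c = 0" "triple a b a = 0" "triple a c c = 0"
  by (simp_all add: triple_cross cross3_simps)

lemma triple_swap: "triple b a c = - triple a b c" "triple a c b = - triple a b c"
  by (simp_all add: triple_cross cross3_simps)

text \<open>Cramer's rule for the coordinates of \<open>z\<close> in the basis \<open>a\<close>,
  \<open>b\<close>, \<open>c\<close>, multiplied out so that it holds for dependent vectors as
  well.\<close>

lemma triple_Cramer:
  "triple a b c *\<^sub>R z = triple z b c *\<^sub>R a + triple a z c *\<^sub>R b + triple a b z *\<^sub>R c"
  by (simp add: vec_eq_iff forall_3 triple_cross cross3_simps)

lemma triple_matrix: "triple (A *v a) (A *v b) (A *v c) = det A * triple a b c"
proof -
  \<comment> \<open>The transpose of \<open>A\<close> maps the cross product of the images to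
    \<open>det A\<close> times the original cross product; it then moves to the other side of the
    inner product.\<close>
  have "a \<bullet> (transpose A *v cross3 (A *v b) (A *v c)) = det A * triple a b c"
    by (simp only: cross_matrix_mult triple_cross inner_scaleR_right)
  thus ?thesis
    by (metis dot_lmul_matrix inner_commute transpose_matrix_vector triple_cross)
qed

interpretation cross3: bounded_bilinear cross3
  using bilinear_cross bilinear_conv_bounded_bilinear by blast

lemma smooth_on_triple:
  "open S \<Longrightarrow> smooth_on S f \<Longrightarrow> smooth_on S g \<Longrightarrow> smooth_on S h \<Longrightarrow>
    smooth_on S (\<lambda>x. triple (f x) (g x) (h x))"
  unfolding triple_cross by (intro smooth_on_inner cross3.smooth_on_prod)

lemma has_vector_derivative_triple:
  assumes "f differentiable (at x)" "g differentiable (at x)" "h differentiable (at x)"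
  shows "((\<lambda>x. triple (f x) (g x) (h x)) has_vector_derivative
           triple (vderiv f x) (g x) (h x) + triple (f x) (vderiv g x) (h x) +
           triple (f x) (g x) (vderiv h x)) (at x)"
  unfolding triple_cross
  using bounded_bilinear.has_vector_derivative[OF bounded_bilinear_inner has_vderiv[OF assms(1)]
      cross3.has_vector_derivative[OF has_vderiv has_vderiv, OF assms(2,3)]]
  by (simp add: inner_add_right add_ac)

lemma vderiv_triple:
  assumes "f differentiable (at x)" "g differentiable (at x)" "h differentiable (at x)"
  shows "vderiv (\<lambda>x. triple (f x) (g x) (h x)) x =
           triple (vderiv f x) (g x) (h x) + triple (f x) (vderiv g x) (h x) +
           triple (f x) (g x) (vderiv h x)"
  by (rule vderiv_eqI has_vector_derivative_triple assms)+

definition wronskian :: "(real \<Rightarrow> real^3) \<Rightarrow> real \<Rightarrow> real" where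
  "wronskian f x = triple (f x) (vderiv f x) (vderiv (vderiv f) x)"

lemma vderiv_2: "(vderiv ^^ 2) f = vderiv (vderiv f)"
  and vderiv_3: "(vderiv ^^ 3) f = vderiv (vderiv (vderiv f))"
  by (simp_all add: eval_nat_numeral)

lemma wronskian_nonzero: "wronskian f x \<noteq> 0 \<Longrightarrow> f x \<noteq> 0"
  by (auto simp: wronskian_def)

lemma smooth_on_wronskian: "open S \<Longrightarrow> smooth_on S f \<Longrightarrow> smooth_on S (wronskian f)"
  unfolding wronskian_def[abs_def] by (intro smooth_on_triple smooth_on_vderiv)

text \<open>The other two terms of the product rule repeat a vector. A constant Wronskian therefore
  leaves f''' without a component along f'', hence an equation with only two coefficients.\<close>

lemma vderiv_wronskian:
  assumes "smooth_on UNIV f"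
  shows "vderiv (wronskian f) x = triple (f x) (vderiv f x) (vderiv (vderiv (vderiv f)) x)"
  unfolding wronskian_def[abs_def] using assms
  by (subst vderiv_triple) (auto intro!: smooth_on_differentiable[of UNIV] smooth_on_vderiv)

lemma wronskian_cong:
  assumes "open S" "x \<in> S" "\<And>y. y \<in> S \<Longrightarrow> f y = g y"
  shows "wronskian f x = wronskian g x"
  using vderiv_funpow_cong[OF assms, where n = 1] vderiv_funpow_cong[OF assms, where n = 2] assms
  by (simp add: wronskian_def vderiv_2)

text \<open>Derivatives of \<open>k\<close> only add multiples of earlier entries of the
  determinant, so each of the three entries contributes one factor \<open>k x\<close>.\<close>

lemma wronskian_scaleR:
  assumes "open S" "x \<in> S" "smooth_on S k" "smooth_on S f"
  shows "wronskian (\<lambda>y. k y *\<^sub>R f y) x = k x ^ 3 * wronskian f x"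
proof -
  have diff: "(vderiv ^^ n) k differentiable (at y)" "(vderiv ^^ n) f differentiable (at y)"
    if "y \<in> S" for y n
    using assms that by (auto intro: smooth_on_differentiable[of S] smooth_on_vderiv_funpow)
  note diff = diff[where n = 0, simplified] diff[where n = 1, simplified]
  have 1: "vderiv (\<lambda>y. k y *\<^sub>R f y) y = k y *\<^sub>R vderiv f y + vderiv k y *\<^sub>R f y" if "y \<in> S" for y
    using that diff by (intro vderiv_scaleR)
  have "vderiv (vderiv (\<lambda>y. k y *\<^sub>R f y)) x = vderiv (\<lambda>y. k y *\<^sub>R vderiv f y + vderiv k y *\<^sub>R f y) x"
    using 1 by (intro vderiv_cong[OF assms(1,2)])
  also have "\<dots> = vderiv (\<lambda>y. k y *\<^sub>R vderiv f y) x + vderiv (\<lambda>y. vderiv k y *\<^sub>R f y) x"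
    using diff[OF assms(2)] by (intro vderiv_add) (auto intro!: differentiable_scaleR)
  also have "\<dots> = k x *\<^sub>R vderiv (vderiv f) x + vderiv k x *\<^sub>R vderiv f x
      + (vderiv k x *\<^sub>R vderiv f x + vderiv (vderiv k) x *\<^sub>R f x)"
    using diff[OF assms(2)] by (simp add: vderiv_scaleR)
  finally have 2: "vderiv (vderiv (\<lambda>y. k y *\<^sub>R f y)) x = \<dots>" .
  show ?thesis unfolding wronskian_def 1[OF assms(2)] 2 triple_simps
    by (simp add: power3_eq_cube)
qed

lemma vderiv_matrix_vector:
  fixes A :: "real^'n^'m"
  assumes "f differentiable (at x)"
  shows "vderiv (\<lambda>x. A *v f x) x = A *v vderiv f x"
  by (rule vderiv_linear[OF matrix_vector_mul_bounded_linear assms])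

lemma vderiv_funpow_matrix_vector:
  fixes A :: "real^'n^'m"
  assumes "smooth_on UNIV f"
  shows "(vderiv ^^ n) (\<lambda>x. A *v f x) = (\<lambda>x. A *v (vderiv ^^ n) f x)"
  using assms
proof (induction n arbitrary: f)
  case (Suc n)
  have "vderiv (\<lambda>x. A *v f x) = (\<lambda>x. A *v vderiv f x)"
    using Suc.prems by (intro ext vderiv_matrix_vector smooth_on_differentiable) auto
  thus ?case using Suc by (simp add: vderiv_funpow_Suc smooth_on_vderiv del: funpow.simps)
qed simp

lemma smooth_on_matrix_vector:
  fixes A :: "real^'n^'m"
  assumes "smooth_on UNIV f"
  shows "smooth_on UNIV (\<lambda>x. A *v f x)"
  unfolding smooth_on_def vderiv_funpow_matrix_vector[OF assms]
proof (intro allI ballI)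
  fix n x
  have "(vderiv ^^ n) f differentiable (at x)" using assms by (simp add: smooth_on_def)
  thus "(\<lambda>x. A *v (vderiv ^^ n) f x) differentiable (at x)"
    by (rule differentiableI_vector[OF bounded_linear.has_vector_derivative[OF
            matrix_vector_mul_bounded_linear has_vderiv]])
qed

lemma wronskian_matrix_vector:
  assumes "smooth_on UNIV f"
  shows "wronskian (\<lambda>x. A *v f x) x = det A * wronskian f x"
  using vderiv_funpow_matrix_vector[OF assms, of 1 A] vderiv_funpow_matrix_vector[OF assms, of 2 A]
  by (simp add: wronskian_def vderiv_2 triple_matrix)

lemma wronskian_shift: "wronskian (\<lambda>x. f (x + a)) x = wronskian f (x + a)"
  by (simp add: wronskian_def vderiv_shift[abs_def])

text \<open>The proportionality factor has a constant cube, and the real cube root is unique, so it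
  is constant without a sign or continuity argument. This yields both the uniqueness of unimodular
  lifts and their monodromy.\<close>

lemma collinear_lifts:
  assumes "smooth_on UNIV f" "smooth_on UNIV g" "\<And>x. wronskian g x \<noteq> 0"
    and "\<And>x. f x \<in> span {g x}" "\<And>x. wronskian f x = c * wronskian g x"
  shows "f x = root 3 c *\<^sub>R g x"
proof -
  have [simp]: "g x \<noteq> 0" for x using assms(3) by (rule wronskian_nonzero)
  \<comment> \<open>The inner product expresses the factor by a formula that is visibly
    smooth.\<close>
  define k where "k x = (f x \<bullet> g x) * inverse (g x \<bullet> g x)" for x
  have f: "f = (\<lambda>x. k x *\<^sub>R g x)"
  proof
    fix x
    obtain r where "f x = r *\<^sub>R g x" using assms(4)[of x] by (auto simp: span_singleton)
    thus "f x = k x *\<^sub>R g x" by (simp add: k_def field_simps)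
  qed
  have "smooth_on UNIV k" unfolding k_def
    using assms by (intro smooth_on_mult smooth_on_inverse smooth_on_inner) auto
  hence "k x ^ 3 * wronskian g x = c * wronskian g x"
    using assms(5)[of x] wronskian_scaleR[of UNIV x k g] assms(2) by (simp add: f)
  hence "k x ^ 3 = c" using assms(3)[of x] by simp
  hence "k x = root 3 c" using odd_real_root_power_cancel[of 3 "k x"] by simp
  thus ?thesis by (simp add: f)
qed

section \<open>Lifts of curves in the projective plane\<close>

lemma Rep_rp2_eq_span:
  assumes "v \<in> Rep_rp2 p" "v \<noteq> 0"
  shows "Rep_rp2 p = span {v}"
proof -
  have "subspace (Rep_rp2 p)" "dim (Rep_rp2 p) = 1" using Rep_rp2[of p] by auto
  thus ?thesis
    using assms by (intro subspace_dim_equal[symmetric] subspace_span span_minimal) auto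
qed

definition pt :: "real^3 \<Rightarrow> rp2" where
  "pt v = Abs_rp2 (span {v})"

lemma Rep_pt: "v \<noteq> 0 \<Longrightarrow> Rep_rp2 (pt v) = span {v}"
  unfolding pt_def by (rule Abs_rp2_inverse) (simp add: dim_insert)

lemma rp2_eqI:
  assumes "v \<in> Rep_rp2 p" "v \<in> Rep_rp2 q" "v \<noteq> 0"
  shows "p = q"
  using assms Rep_rp2_eq_span Rep_rp2_inject by metis

lemma in_chart_iff:
  assumes "v \<in> Rep_rp2 p" "v \<noteq> 0"
  shows "in_chart i p \<longleftrightarrow> v $ i \<noteq> 0"
  unfolding in_chart_def Rep_rp2_eq_span[OF assms] by (auto simp: span_singleton intro!: exI[of _ 1])

lemma ex_in_chart: "\<exists>i. in_chart i p"
proof -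
  have "dim (Rep_rp2 p) \<noteq> 0" using Rep_rp2[of p] by simp
  then obtain v where "v \<in> Rep_rp2 p" "v \<noteq> 0" unfolding dim_eq_0 by blast
  thus ?thesis unfolding in_chart_def by (metis vec_eq_iff zero_index)
qed

lemma affine_coord_eq:
  assumes "v \<in> Rep_rp2 p" "v $ i \<noteq> 0"
  shows "affine_coord i p = inverse (v $ i) *\<^sub>R v"
proof -
  have "Rep_rp2 p = span {v}" using assms by (intro Rep_rp2_eq_span) auto
  thus ?thesis unfolding affine_coord_def
    using assms by (intro the_equality) (auto simp: span_singleton field_simps)
qed

lemma affine_coord_in_Rep:
  assumes "in_chart i p"
  shows "affine_coord i p \<in> Rep_rp2 p" "affine_coord i p \<noteq> 0"
proof -
  obtain v where v: "v \<in> Rep_rp2 p" "v $ i \<noteq> 0" using assms by (auto simp: in_chart_def)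
  moreover have "subspace (Rep_rp2 p)" using Rep_rp2[of p] by auto
  ultimately show "affine_coord i p \<in> Rep_rp2 p" by (simp add: affine_coord_eq subspace_scale)
  show "affine_coord i p \<noteq> 0" using v by (auto simp: affine_coord_eq)
qed

text \<open>Smoothness, nondegeneracy and tangent lines are insensitive to rescaling, so a nonzero
  Wronskian suffices. They can thus be read off from a lift of the envelope before it is made
  unimodular.\<close>

definition regular_lift :: "(real \<Rightarrow> rp2) \<Rightarrow> (real \<Rightarrow> real^3) \<Rightarrow> bool" where
  "regular_lift \<gamma> f \<longleftrightarrow> smooth_on UNIV f \<and> (\<forall>x. f x \<in> Rep_rp2 (\<gamma> x)) \<and> (\<forall>x. wronskian f x \<noteq> 0)"

lemma unimodular_lift_iff:
  "unimodular_lift \<gamma> f \<longleftrightarrow>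
     smooth_on UNIV f \<and> (\<forall>x. f x \<in> Rep_rp2 (\<gamma> x)) \<and> (\<forall>x. wronskian f x = 1)"
  by (simp add: unimodular_lift_def wronskian_def triple_def vderiv_2)

lemma smooth_on_nth: "open S \<Longrightarrow> smooth_on S f \<Longrightarrow> smooth_on S (\<lambda>x. f x $ i :: real)"
  using smooth_on_inner[of S "\<lambda>_. axis i 1" f] by (simp add: cart_eq_inner_axis inner_commute)

text \<open>An affine chart is itself a local lift, obtained by dividing \<open>f\<close> by its
  \<open>i\<close>-th coordinate. Statements in charts thereby reduce to the rescaling rule for
  Wronskians.\<close>

lemma regular_lift_chart:
  assumes "regular_lift \<gamma> f" "in_chart i (\<gamma> x)"
  shows "\<exists>S k. open S \<and> x \<in> S \<and> smooth_on S k \<and>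
    (\<forall>y\<in>S. k y \<noteq> 0 \<and> in_chart i (\<gamma> y) \<and> affine_coord i (\<gamma> y) = k y *\<^sub>R f y)"
proof (intro exI conjI ballI)
  define S where "S = {y. f y $ i \<noteq> 0}"
  define k where "k y = inverse (f y $ i)" for y
  have f: "smooth_on UNIV f" "f y \<in> Rep_rp2 (\<gamma> y)" "f y \<noteq> 0" for y
    using assms(1) wronskian_nonzero by (auto simp: regular_lift_def)
  show "open S" unfolding S_def
    by (intro open_Collect_neq smooth_on_continuous smooth_on_nth f) auto
  thus "smooth_on S k" unfolding k_def
    by (intro smooth_on_inverse smooth_on_nth smooth_on_UNIV[OF f(1)]) (simp_all add: S_def)
  show "x \<in> S" using assms(2) in_chart_iff[OF f(2)[of x] f(3)[of x]] by (simp add: S_def)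
  show "k y \<noteq> 0" "in_chart i (\<gamma> y)" "affine_coord i (\<gamma> y) = k y *\<^sub>R f y" if "y \<in> S" for y
    using that in_chart_iff[OF f(2)[of y] f(3)[of y]] affine_coord_eq[OF f(2)[of y]]
    by (simp_all add: S_def k_def)
qed

lemma regular_lift_smooth_curve:
  assumes "regular_lift \<gamma> f"
  shows "smooth_curve \<gamma>"
  unfolding smooth_curve_def
proof (intro allI impI)
  fix x i assume i: "in_chart i (\<gamma> x)"
  obtain S k where S: "open S" "x \<in> S" "smooth_on S k"
    and k: "\<forall>y\<in>S. k y \<noteq> 0 \<and> in_chart i (\<gamma> y) \<and> affine_coord i (\<gamma> y) = k y *\<^sub>R f y"
    using regular_lift_chart[OF assms i] by blast
  have "smooth_on S f" using assms by (auto simp: regular_lift_def intro: smooth_on_UNIV)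
  hence "smooth_on S (\<lambda>y. k y *\<^sub>R f y)" using S by (intro smooth_on_scaleR)
  hence "smooth_on S (\<lambda>y. affine_coord i (\<gamma> y))" by (rule smooth_on_cong[OF S(1), rotated]) (simp add: k)
  thus "\<exists>S. open S \<and> x \<in> S \<and> (\<forall>y\<in>S. in_chart i (\<gamma> y)) \<and> smooth_on S (\<lambda>y. affine_coord i (\<gamma> y))"
    using S k by blast
qed

lemma regular_lift_chart_wronskian:
  assumes "regular_lift \<gamma> f" "in_chart i (\<gamma> x)"
  shows "wronskian (\<lambda>y. affine_coord i (\<gamma> y)) x \<noteq> 0"
proof -
  obtain S k where S: "open S" "x \<in> S" "smooth_on S k"
    and k: "\<forall>y\<in>S. k y \<noteq> 0 \<and> in_chart i (\<gamma> y) \<and> affine_coord i (\<gamma> y) = k y *\<^sub>R f y"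
    using regular_lift_chart[OF assms] by blast
  have "smooth_on S f" using assms by (auto simp: regular_lift_def intro: smooth_on_UNIV)
  hence *: "wronskian (\<lambda>y. k y *\<^sub>R f y) x = k x ^ 3 * wronskian f x"
    by (rule wronskian_scaleR[OF S(1-3)])
  have "wronskian (\<lambda>y. affine_coord i (\<gamma> y)) x = k x ^ 3 * wronskian f x"
    unfolding *[symmetric] by (rule wronskian_cong[OF S(1,2)]) (simp add: k)
  thus ?thesis using S(2) k assms(1) by (simp add: regular_lift_def)
qed

lemma regular_lift_nondegenerate:
  assumes "regular_lift \<gamma> f" "invertible M" "\<And>x. \<gamma> (x + 1) = proj_map M (\<gamma> x)"
  shows "nondegenerate_curve M \<gamma>"
  unfolding nondegenerate_curve_def Let_def
proof (intro conjI allI impI)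
  fix x i a b
  let ?c = "\<lambda>y. affine_coord i (\<gamma> y)"
  assume "in_chart i (\<gamma> x)"
  hence W: "wronskian ?c x \<noteq> 0" by (rule regular_lift_chart_wronskian[OF assms(1)])
  assume 0: "a *\<^sub>R vderiv ?c x + b *\<^sub>R (vderiv ^^ 2) ?c x = 0"
  \<comment> \<open>Pairing the linear relation with the point and its first derivative isolates
    \<open>b\<close>; with the point and its second derivative it isolates \<open>a\<close>.\<close>
  have "b * wronskian ?c x = triple (?c x) (vderiv ?c x) (a *\<^sub>R vderiv ?c x + b *\<^sub>R (vderiv ^^ 2) ?c x)"
    by (simp add: wronskian_def vderiv_2)
  thus "b = 0" using W by (simp only: 0 triple_simps mult_eq_0_iff) simp
  have "a * wronskian ?c x =
      triple (?c x) (a *\<^sub>R vderiv ?c x + b *\<^sub>R (vderiv ^^ 2) ?c x) (vderiv (vderiv ?c) x)"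
    by (simp add: wronskian_def vderiv_2)
  thus "a = 0" using W by (simp only: 0 triple_simps mult_eq_0_iff) simp
qed (use assms regular_lift_smooth_curve in auto)

text \<open>A dimension count: the span of \<open>p\<close> and \<open>q\<close> has dimension at
  most 2 and contains \<open>a\<close> and \<open>b\<close>, whose independence is witnessed by
  \<open>c\<close>.\<close>

lemma span_pair_eq:
  assumes "a \<in> span {p, q}" "b \<in> span {p, q}" "triple a b c \<noteq> 0"
  shows "span {p, q} = span {a, b :: real^3}"
proof -
  have ab: "a \<noteq> b" "a \<notin> span {b}" "b \<noteq> 0" using assms(3) by (auto simp: span_singleton)
  hence "independent {a, b}" by (simp add: independent_insert)
  hence "dim (span {a, b}) = 2" using ab(1) by (simp add: dim_eq_card_independent)
  moreover have "dim (span {p, q}) \<le> 2"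
    using dim_le_card'[of "{p, q}"] card_insert_le_m1[of 2 "{q}" p] by (simp add: card_insert_if)
  ultimately show ?thesis using assms(1,2)
    by (intro subspace_dim_equal[symmetric] subspace_span span_minimal) auto
qed

lemma regular_lift_tangent:
  assumes "regular_lift \<gamma> f"
  shows "tangent_at (span {f x, vderiv f x}) \<gamma> x"
  unfolding tangent_at_def Let_def
proof (intro allI impI conjI)
  fix i assume i: "in_chart i (\<gamma> x)"
  let ?c = "\<lambda>y. affine_coord i (\<gamma> y)"
  have W: "wronskian ?c x \<noteq> 0" by (rule regular_lift_chart_wronskian[OF assms i])
  thus "vderiv ?c x \<noteq> 0" by (auto simp: wronskian_def)
  obtain S k where S: "open S" "x \<in> S" "smooth_on S k"
    and k: "\<forall>y\<in>S. k y \<noteq> 0 \<and> in_chart i (\<gamma> y) \<and> affine_coord i (\<gamma> y) = k y *\<^sub>R f y"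
    using regular_lift_chart[OF assms i] by blast
  have f: "smooth_on S f" using assms by (auto simp: regular_lift_def intro: smooth_on_UNIV)
  have "vderiv ?c x = vderiv (\<lambda>y. k y *\<^sub>R f y) x" by (rule vderiv_cong[OF S(1,2)]) (simp add: k)
  also have "\<dots> = k x *\<^sub>R vderiv f x + vderiv k x *\<^sub>R f x"
    by (intro vderiv_scaleR smooth_on_differentiable[OF S(3,2)] smooth_on_differentiable[OF f S(2)])
  finally have "vderiv ?c x \<in> span {f x, vderiv f x}"
    by (simp add: span_add span_scale span_base)
  moreover have "?c x \<in> span {f x, vderiv f x}"
    using S(2) k by (simp add: span_scale span_base)
  ultimately show "span {f x, vderiv f x} = span {?c x, vderiv ?c x}"
    using W unfolding wronskian_def by (intro span_pair_eq)
qed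

lemma regular_lift_is_envelope:
  "regular_lift \<gamma> f \<Longrightarrow> is_envelope (\<lambda>x. span {f x, vderiv f x}) \<gamma>"
  by (simp add: is_envelope_def regular_lift_smooth_curve regular_lift_tangent)

lemma span_pair_triple:
  assumes "z \<in> span {a, b}"
  shows "triple z a b = 0"
proof -
  obtain r s where "z = r *\<^sub>R a + s *\<^sub>R b" using assms
    by (auto simp: span_insert span_singleton algebra_simps)
  thus ?thesis by simp
qed

text \<open>The point of an envelope on the line \<open>l x\<close> is the only one at which the linear form defining
  \<open>l x\<close> and the derivative of that form with respect to \<open>x\<close> both vanish.\<close>

lemma envelope_unique:
  assumes "regular_lift \<gamma> f" "is_envelope (\<lambda>x. span {f x, vderiv f x}) \<delta>"
  shows "\<delta> = \<gamma>"
proof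
  fix x
  obtain i where i: "in_chart i (\<delta> x)" using ex_in_chart by blast
  let ?c = "\<lambda>y. affine_coord i (\<delta> y)"
  obtain S where S: "open S" "x \<in> S" "\<And>y. y \<in> S \<Longrightarrow> in_chart i (\<delta> y)" "smooth_on S ?c"
    using assms(2) i unfolding is_envelope_def smooth_curve_def by blast
  have f: "smooth_on UNIV f" "wronskian f x \<noteq> 0" "f x \<in> Rep_rp2 (\<gamma> x)"
    using assms(1) by (auto simp: regular_lift_def)
  have l: "span {f y, vderiv f y} = span {?c y, vderiv ?c y}" if "y \<in> S" for y
    using assms(2) S(3)[OF that] unfolding is_envelope_def tangent_at_def Let_def by blast
  have "?c y \<in> span {f y, vderiv f y}" if "y \<in> S" for y
    unfolding l[OF that] by (simp add: span_base)
  hence "triple (?c y) (f y) (vderiv f y) = 0" if "y \<in> S" for y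
    using that by (intro span_pair_triple)
  hence "vderiv (\<lambda>y. triple (?c y) (f y) (vderiv f y)) x = vderiv (\<lambda>y. 0) x"
    by (intro vderiv_cong[OF S(1,2)])
  moreover have "vderiv (\<lambda>y. triple (?c y) (f y) (vderiv f y)) x =
      triple (vderiv ?c x) (f x) (vderiv f x) + triple (?c x) (vderiv f x) (vderiv f x) +
      triple (?c x) (f x) (vderiv (vderiv f) x)"
    using smooth_on_differentiable[OF S(4,2)] smooth_on_differentiable[OF f(1)]
      smooth_on_differentiable[OF smooth_on_vderiv[OF f(1)]]
    by (intro vderiv_triple) auto
  \<comment> \<open>By tangency the velocity lies in the line too, so of the product rule only the
    term with the derivative of the linear form survives.\<close>
  moreover have "triple (vderiv ?c x) (f x) (vderiv f x) = 0"
    by (rule span_pair_triple, unfold l[OF S(2)]) (simp add: span_base)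
  ultimately have 0: "triple (?c x) (f x) (vderiv (vderiv f) x) = 0" by simp
  have "?c x \<in> span {f x, vderiv f x}" unfolding l[OF S(2)] by (simp add: span_base)
  then obtain r s where rs: "?c x = r *\<^sub>R f x + s *\<^sub>R vderiv f x"
    by (auto simp: span_insert span_singleton algebra_simps)
  have "s * wronskian f x = 0" using 0 by (simp add: rs triple_swap(1)[of "f x"] wronskian_def)
  hence "?c x = r *\<^sub>R f x" using f by (simp add: rs)
  moreover have "subspace (Rep_rp2 (\<gamma> x))" using Rep_rp2 by auto
  ultimately have "?c x \<in> Rep_rp2 (\<gamma> x)" using f by (simp add: subspace_scale)
  thus "\<delta> x = \<gamma> x" using affine_coord_in_Rep[OF i] by (intro rp2_eqI)
qed

section \<open>Uniqueness of the unimodular lift and of the pair of functions\<close>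

lemma unimodular_lift_unique:
  assumes "unimodular_lift \<gamma> f" "unimodular_lift \<gamma> g"
  shows "f = g"
proof
  fix x
  have "f x = root 3 1 *\<^sub>R g x"
  proof (rule collinear_lifts)
    show "f x \<in> span {g x}" for x
    proof -
      have "g x \<in> Rep_rp2 (\<gamma> x)" "g x \<noteq> 0" "f x \<in> Rep_rp2 (\<gamma> x)"
        using assms by (auto simp: unimodular_lift_iff wronskian_def)
           (metis triple_simps(13) zero_neq_one)
      thus ?thesis using Rep_rp2_eq_span by metis
    qed
  qed (use assms in \<open>auto simp: unimodular_lift_iff\<close>)
  thus "f x = g x" by simp
qed

text \<open>Pairing the equation with f and f'' leaves only \<open>u\<close>, and pairing it with f'
  and f'' leaves only v. Any lift may be used because there is only one.\<close>

lemma corresponds_coefficients: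
  assumes "corresponds \<gamma> u w" "unimodular_lift \<gamma> f"
  shows "u x = - triple (f x) ((vderiv ^^ 3) f x) (vderiv (vderiv f) x)"
    and "w x = - triple ((vderiv ^^ 3) f x) (vderiv f x) (vderiv (vderiv f) x) - vderiv u x / 2"
proof -
  obtain g v where g: "unimodular_lift \<gamma> g"
    and "\<forall>x. (vderiv ^^ 3) g x + u x *\<^sub>R vderiv g x + v x *\<^sub>R g x = 0"
    and "w = (\<lambda>x. v x - vderiv u x / 2)"
    using assms(1) unfolding corresponds_def deriv_eq_vderiv by blast
  hence *: "(vderiv ^^ 3) f x + u x *\<^sub>R vderiv f x + v x *\<^sub>R f x = 0" "w x = v x - vderiv u x / 2"
    unfolding unimodular_lift_unique[OF assms(2) g] by simp_all
  have W: "triple (f x) (vderiv f x) (vderiv (vderiv f) x) = 1"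
    using assms(2) by (simp add: unimodular_lift_iff wronskian_def)
  have **: "(vderiv ^^ 3) f x = - u x *\<^sub>R vderiv f x - v x *\<^sub>R f x"
    using *(1) by (simp add: algebra_simps eq_neg_iff_add_eq_0)
  show "u x = - triple (f x) ((vderiv ^^ 3) f x) (vderiv (vderiv f) x)"
    by (simp add: ** W)
  show "w x = - triple ((vderiv ^^ 3) f x) (vderiv f x) (vderiv (vderiv f) x) - vderiv u x / 2"
    by (simp add: ** W *)
qed

lemma corresponds_unique:
  assumes "corresponds \<gamma> u w" "corresponds \<gamma> u' w'"
  shows "u = u'" "w = w'"
proof -
  obtain f where f: "unimodular_lift \<gamma> f" using assms by (auto simp: corresponds_def)
  show u: "u = u'"
    by (rule ext) (simp only: corresponds_coefficients(1)[OF assms(1) f] corresponds_coefficients(1)[OF assms(2) f])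
  show "w = w'"
    by (rule ext) (simp only: corresponds_coefficients(2)[OF assms(1) f] corresponds_coefficients(2)[OF assms(2) f] u)
qed

lemma corresponds_corr:
  assumes "corresponds \<gamma> u w"
  shows "corr_u \<gamma> = u" "corr_w \<gamma> = w"
  unfolding corr_u_def corr_w_def
  by (intro the_equality; use assms corresponds_unique[OF _ assms] in blast)+

text \<open>The lift is not periodic, but its monodromy has determinant 1 and so drops out of the
  triple products that define the coefficients.\<close>

lemma corresponds_unimodular_lift:
  assumes "unimodular_lift \<gamma> f" "\<And>x. f (x + 1) = A *v f x"
  defines "u \<equiv> \<lambda>x. - triple (f x) ((vderiv ^^ 3) f x) (vderiv (vderiv f) x)"
    and "v \<equiv> \<lambda>x. - triple ((vderiv ^^ 3) f x) (vderiv f x) (vderiv (vderiv f) x)"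
  shows "corresponds \<gamma> u (\<lambda>x. v x - vderiv u x / 2)"
proof -
  have f: "smooth_on UNIV f" and W: "wronskian f = (\<lambda>x. 1)"
    using assms(1) by (auto simp: unimodular_lift_iff)
  have shift: "(vderiv ^^ n) f (x + 1) = A *v (vderiv ^^ n) f x" for n x
    using vderiv_funpow_shift[of n f 1] vderiv_funpow_matrix_vector[OF f, of n A] assms(2)
    by (simp add: fun_eq_iff)
  have "wronskian f (x + 1) = det A * wronskian f x" for x
    using shift[of 1] shift[of 2] by (simp add: wronskian_def triple_matrix assms(2) vderiv_2)
  hence "det A = 1" by (simp add: W)
  hence per: "u (x + 1) = u x" "v (x + 1) = v x" for x
    using shift[of 1] shift[of 2] shift[of 3]
    by (simp_all add: u_def v_def triple_matrix assms(2) vderiv_2)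
  have sm: "smooth_on UNIV u" "smooth_on UNIV v"
    unfolding u_def v_def vderiv_3
    by (intro smooth_on_minus smooth_on_triple smooth_on_vderiv f open_UNIV)+
  \<comment> \<open>The third coefficient in Cramer's rule is the derivative of the constant
    Wronskian.\<close>
  have "(vderiv ^^ 3) f x = (- v x) *\<^sub>R f x + (- u x) *\<^sub>R vderiv f x" for x
    using triple_Cramer[of "f x" "vderiv f x" "vderiv (vderiv f) x" "(vderiv ^^ 3) f x"]
      vderiv_wronskian[OF f, of x] fun_cong[OF W, of x, unfolded wronskian_def]
    by (simp add: W u_def v_def flip: vderiv_3)
  hence ode: "(vderiv ^^ 3) f x + u x *\<^sub>R vderiv f x + v x *\<^sub>R f x = 0" for x
    by simp
  show ?thesis unfolding corresponds_def smooth_periodic_def deriv_eq_vderiv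
    using assms(1) sm per ode by (intro exI[of _ f] exI[of _ v]) auto
qed

section \<open>The monodromy of the unimodular lift\<close>

lemma subspace_matrix_image: "subspace V \<Longrightarrow> subspace ((*v) (A :: real^'n^'m) ` V)"
  by (rule linear_subspace_image) auto

lemma Rep_proj_map:
  fixes M :: "real^3^3"
  assumes "invertible M"
  shows "Rep_rp2 (proj_map M p) = (*v) M ` Rep_rp2 p"
proof -
  have "dim ((*v) M ` Rep_rp2 p) = dim (Rep_rp2 p)"
    using assms by (intro dim_image_eq inj_on_subset[OF inj_matrix_vector_mult]) auto
  thus ?thesis unfolding proj_map_def
    using Rep_rp2[of p] by (intro Abs_rp2_inverse) (auto simp: subspace_matrix_image)
qed

text \<open>Both f(x + 1) and M f(x) lift \<gamma>(x + 1), with Wronskians 1 and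
  \<open>det M\<close>. They therefore differ by the cube root of 1 / \<open>det M\<close>, which
  makes the monodromy unimodular.\<close>

lemma unimodular_lift_monodromy:
  assumes "invertible M" "\<And>x. \<gamma> (x + 1) = proj_map M (\<gamma> x)" "unimodular_lift \<gamma> f"
  obtains c where "c \<noteq> 0" "det (c *\<^sub>R M) = 1" "\<And>x. f (x + 1) = (c *\<^sub>R M) *v f x"
proof
  have f: "smooth_on UNIV f" "wronskian f x = 1" "f x \<in> Rep_rp2 (\<gamma> x)" for x
    using assms(3) by (auto simp: unimodular_lift_iff)
  have M: "det M \<noteq> 0" using assms(1) by (simp add: invertible_det_nz)
  define c where "c = root 3 (inverse (det M))"
  show "c \<noteq> 0" using M by (simp add: c_def)
  have c3: "c ^ 3 = inverse (det M)" by (simp add: c_def odd_real_root_pow)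
  have fM: "f (x + 1) = c *\<^sub>R (M *v f x)" for x
    unfolding c_def
  proof (rule collinear_lifts[where f = "\<lambda>x. f (x + 1)"])
    show "smooth_on UNIV (\<lambda>x. f (x + 1))" "smooth_on UNIV (\<lambda>x. M *v f x)"
      using f by (simp_all add: smooth_on_shift smooth_on_matrix_vector)
    show W: "wronskian (\<lambda>x. M *v f x) x \<noteq> 0" for x
      using M f by (simp add: wronskian_matrix_vector)
    show "wronskian (\<lambda>x. f (x + 1)) x = inverse (det M) * wronskian (\<lambda>x. M *v f x) x" for x
      using M f by (simp add: wronskian_matrix_vector wronskian_shift)
    fix x
    have "M *v f x \<in> Rep_rp2 (\<gamma> (x + 1))" unfolding assms(2) Rep_proj_map[OF assms(1)] using f by blast
    moreover have "M *v f x \<noteq> 0" using W[of x] by (auto simp: wronskian_def)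
    ultimately have "Rep_rp2 (\<gamma> (x + 1)) = span {M *v f x}" by (rule Rep_rp2_eq_span)
    thus "f (x + 1) \<in> span {M *v f x}" using f(3)[of "x + 1"] by simp
  qed
  show "f (x + 1) = (c *\<^sub>R M) *v f x" for x by (simp add: fM scaleR_matrix_vector_assoc)
  have "det (c *\<^sub>R M) = c ^ 3 * det M" by (simp add: det_3 power3_eq_cube algebra_simps)
  thus "det (c *\<^sub>R M) = 1" using M by (simp add: c3)
qed

lemma proj_map_pt:
  assumes "invertible M" "v \<noteq> 0" "c \<noteq> 0"
  shows "pt ((c *\<^sub>R M) *v v) = proj_map M (pt v)"
proof (rule rp2_eqI)
  have "M *v v \<noteq> 0" using assms by (metis matrix_left_invertible_ker invertible_def)
  hence "(c *\<^sub>R M) *v v \<noteq> 0" using assms by (simp add: scaleR_matrix_vector_assoc[symmetric])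
  thus "(c *\<^sub>R M) *v v \<in> Rep_rp2 (pt ((c *\<^sub>R M) *v v))" "(c *\<^sub>R M) *v v \<noteq> 0"
    by (simp_all add: Rep_pt span_base)
  have "(c *\<^sub>R M) *v v = M *v (c *\<^sub>R v)"
    by (simp add: scaleR_matrix_vector_assoc[symmetric] matrix_vector_mult_scaleR)
  moreover have "c *\<^sub>R v \<in> span {v}" by (simp add: span_scale span_base)
  ultimately show "(c *\<^sub>R M) *v v \<in> Rep_rp2 (proj_map M (pt v))"
    using assms by (simp add: Rep_proj_map Rep_pt)
qed

section \<open>Expansions with bounded derivatives\<close>

definition bounded_O :: "nat \<Rightarrow> (real \<Rightarrow> real \<Rightarrow> 'a::real_normed_vector) \<Rightarrow> bool" where
  "bounded_O n F \<longleftrightarrow> (\<exists>C. \<forall>\<^sub>F \<epsilon> in at_right 0. \<forall>x\<in>{0..1}. norm (F \<epsilon> x) \<le> C * \<epsilon> ^ n)"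

definition smooth_O :: "nat \<Rightarrow> nat \<Rightarrow> (real \<Rightarrow> real \<Rightarrow> 'a::real_normed_vector) \<Rightarrow> bool" where
  "smooth_O k n F \<longleftrightarrow> (\<forall>\<^sub>F \<epsilon> in at_right 0. smooth_on UNIV (F \<epsilon>)) \<and>
     (\<forall>j\<le>k. bounded_O n (\<lambda>\<epsilon>. (vderiv ^^ j) (F \<epsilon>)))"

lemma eventually_small: "c > 0 \<Longrightarrow> \<forall>\<^sub>F \<epsilon> in at_right 0. 0 < \<epsilon> \<and> \<epsilon> < (c :: real)"
  unfolding eventually_at_right_field by (auto intro!: exI[of _ c])

lemma bounded_OE:
  assumes "bounded_O n F"
  obtains C where "C \<ge> 0" "\<forall>\<^sub>F \<epsilon> in at_right 0. \<forall>x\<in>{0..1}. norm (F \<epsilon> x) \<le> C * \<epsilon> ^ n"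
proof -
  obtain C where "\<forall>\<^sub>F \<epsilon> in at_right 0. \<forall>x\<in>{0..1}. norm (F \<epsilon> x) \<le> C * \<epsilon> ^ n"
    using assms by (auto simp: bounded_O_def)
  hence "\<forall>\<^sub>F \<epsilon> in at_right 0. \<forall>x\<in>{0..1}. norm (F \<epsilon> x) \<le> \<bar>C\<bar> * \<epsilon> ^ n"
    using eventually_small[OF zero_less_one]
  proof eventually_elim
    case (elim \<epsilon>)
    hence "C * \<epsilon> ^ n \<le> \<bar>C\<bar> * \<epsilon> ^ n" by (intro mult_right_mono) auto
    thus ?case using elim(1) by (meson order_trans)
  qed
  thus ?thesis using that[of "\<bar>C\<bar>"] by simp
qed

lemma bounded_O_cong:
  assumes "bounded_O n F" "\<forall>\<^sub>F \<epsilon> in at_right 0. F \<epsilon> = G \<epsilon>"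
  shows "bounded_O n G"
proof -
  obtain C where "\<forall>\<^sub>F \<epsilon> in at_right 0. \<forall>x\<in>{0..1}. norm (F \<epsilon> x) \<le> C * \<epsilon> ^ n"
    using assms by (auto simp: bounded_O_def)
  hence "\<forall>\<^sub>F \<epsilon> in at_right 0. \<forall>x\<in>{0..1}. norm (G \<epsilon> x) \<le> C * \<epsilon> ^ n"
    using assms(2) by eventually_elim simp
  thus ?thesis by (auto simp: bounded_O_def)
qed

lemma bounded_O_mono:
  assumes "bounded_O n F" "m \<le> n"
  shows "bounded_O m F"
proof -
  obtain C where C: "C \<ge> 0" "\<forall>\<^sub>F \<epsilon> in at_right 0. \<forall>x\<in>{0..1}. norm (F \<epsilon> x) \<le> C * \<epsilon> ^ n"
    using assms bounded_OE by blast
  have "\<forall>\<^sub>F \<epsilon> in at_right 0. \<forall>x\<in>{0..1}. norm (F \<epsilon> x) \<le> C * \<epsilon> ^ m"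
    using C(2) eventually_small[OF zero_less_one]
  proof eventually_elim
    case (elim \<epsilon>)
    hence "C * \<epsilon> ^ n \<le> C * \<epsilon> ^ m" using C(1) assms(2) by (intro mult_left_mono power_decreasing) auto
    thus ?case using elim(1) by (meson order_trans)
  qed
  thus ?thesis by (auto simp: bounded_O_def)
qed

lemma bounded_O_add:
  assumes "bounded_O n F" "bounded_O n G"
  shows "bounded_O n (\<lambda>\<epsilon> x. F \<epsilon> x + G \<epsilon> x)"
proof -
  obtain C D where "\<forall>\<^sub>F \<epsilon> in at_right 0. \<forall>x\<in>{0..1}. norm (F \<epsilon> x) \<le> C * \<epsilon> ^ n"
    "\<forall>\<^sub>F \<epsilon> in at_right 0. \<forall>x\<in>{0..1}. norm (G \<epsilon> x) \<le> D * \<epsilon> ^ n"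
    using assms by (auto simp: bounded_O_def)
  hence "\<forall>\<^sub>F \<epsilon> in at_right 0. \<forall>x\<in>{0..1}. norm (F \<epsilon> x + G \<epsilon> x) \<le> (C + D) * \<epsilon> ^ n"
  proof eventually_elim
    case (elim \<epsilon>)
    show ?case
    proof
      fix x :: real assume "x \<in> {0..1}"
      hence "norm (F \<epsilon> x) \<le> C * \<epsilon> ^ n" "norm (G \<epsilon> x) \<le> D * \<epsilon> ^ n" using elim by auto
      thus "norm (F \<epsilon> x + G \<epsilon> x) \<le> (C + D) * \<epsilon> ^ n"
        by (intro norm_triangle_le) (simp add: distrib_right)
    qed
  qed
  thus ?thesis unfolding bounded_O_def by blast
qed

lemma (in bounded_bilinear) bounded_O_prod:
  assumes "bounded_O n F" "bounded_O m G"
  shows "bounded_O (n + m) (\<lambda>\<epsilon> x. prod (F \<epsilon> x) (G \<epsilon> x))"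
proof -
  obtain K where K: "K \<ge> 0" "\<And>a b. norm (prod a b) \<le> norm a * norm b * K"
    using nonneg_bounded by blast
  obtain C D where C: "C \<ge> 0" "\<forall>\<^sub>F \<epsilon> in at_right 0. \<forall>x\<in>{0..1}. norm (F \<epsilon> x) \<le> C * \<epsilon> ^ n"
    and D: "D \<ge> 0" "\<forall>\<^sub>F \<epsilon> in at_right 0. \<forall>x\<in>{0..1}. norm (G \<epsilon> x) \<le> D * \<epsilon> ^ m"
    by (rule bounded_OE[OF assms(1)], rule bounded_OE[OF assms(2)], rule that)
  have "\<forall>\<^sub>F \<epsilon> in at_right 0. \<forall>x\<in>{0..1}. norm (prod (F \<epsilon> x) (G \<epsilon> x)) \<le> (C * D * K) * \<epsilon> ^ (n + m)"
    using C(2) D(2) eventually_small[OF zero_less_one]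
  proof eventually_elim
    case (elim \<epsilon>)
    show ?case
    proof
      fix x :: real assume "x \<in> {0..1}"
      hence *: "norm (F \<epsilon> x) \<le> C * \<epsilon> ^ n" "norm (G \<epsilon> x) \<le> D * \<epsilon> ^ m" using elim by auto
      have "norm (prod (F \<epsilon> x) (G \<epsilon> x)) \<le> norm (F \<epsilon> x) * norm (G \<epsilon> x) * K" by (rule K)
      also have "\<dots> \<le> (C * \<epsilon> ^ n) * (D * \<epsilon> ^ m) * K"
        using elim C(1) D(1) K(1) * by (intro mult_right_mono mult_mono) auto
      finally show "norm (prod (F \<epsilon> x) (G \<epsilon> x)) \<le> (C * D * K) * \<epsilon> ^ (n + m)"
        by (simp add: power_add mult_ac)
    qed
  qed
  thus ?thesis unfolding bounded_O_def by blast
qed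

lemma smooth_O_smooth: "smooth_O k n F \<Longrightarrow> \<forall>\<^sub>F \<epsilon> in at_right 0. smooth_on UNIV (F \<epsilon>)"
  by (simp add: smooth_O_def)

lemma smooth_O_Suc:
  "smooth_O (Suc k) n F \<longleftrightarrow> (\<forall>\<^sub>F \<epsilon> in at_right 0. smooth_on UNIV (F \<epsilon>)) \<and> bounded_O n F \<and>
     smooth_O k n (\<lambda>\<epsilon>. vderiv (F \<epsilon>))"
proof -
  have "(\<forall>j\<le>Suc k. P j) \<longleftrightarrow> P 0 \<and> (\<forall>j\<le>k. P (Suc j))" for P
    by (metis Suc_le_mono le0 not0_implies_Suc)
  moreover have "\<forall>\<^sub>F \<epsilon> in at_right 0. smooth_on UNIV (vderiv (F \<epsilon>))"
    if "\<forall>\<^sub>F \<epsilon> in at_right 0. smooth_on UNIV (F \<epsilon>)"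
    using that by eventually_elim (rule smooth_on_vderiv)
  ultimately show ?thesis
    by (auto simp: smooth_O_def vderiv_funpow_Suc simp del: funpow.simps(2))
qed

lemma smooth_O_0:
  "smooth_O 0 n F \<longleftrightarrow> (\<forall>\<^sub>F \<epsilon> in at_right 0. smooth_on UNIV (F \<epsilon>)) \<and> bounded_O n F"
  by (simp add: smooth_O_def)

lemma smooth_O_bounded: "smooth_O k n F \<Longrightarrow> j \<le> k \<Longrightarrow> bounded_O n (\<lambda>\<epsilon>. (vderiv ^^ j) (F \<epsilon>))"
  by (simp add: smooth_O_def)

lemma smooth_O_vderiv: "smooth_O (Suc k) n F \<Longrightarrow> smooth_O k n (\<lambda>\<epsilon>. vderiv (F \<epsilon>))"
  by (simp add: smooth_O_Suc)

lemma smooth_O_mono: "smooth_O k n F \<Longrightarrow> m \<le> n \<Longrightarrow> smooth_O k m F"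
  by (auto simp: smooth_O_def intro: bounded_O_mono)

lemma smooth_O_lower: "smooth_O k n F \<Longrightarrow> j \<le> k \<Longrightarrow> smooth_O j n F"
  by (simp add: smooth_O_def)

lemma smooth_O_cong:
  assumes "smooth_O k n F" "\<forall>\<^sub>F \<epsilon> in at_right 0. F \<epsilon> = G \<epsilon>"
  shows "smooth_O k n G"
  unfolding smooth_O_def
proof (intro conjI allI impI)
  show "\<forall>\<^sub>F \<epsilon> in at_right 0. smooth_on UNIV (G \<epsilon>)"
    using smooth_O_smooth[OF assms(1)] assms(2) by eventually_elim simp
  fix j assume "j \<le> k"
  hence "bounded_O n (\<lambda>\<epsilon>. (vderiv ^^ j) (F \<epsilon>))" by (rule smooth_O_bounded[OF assms(1)])
  thus "bounded_O n (\<lambda>\<epsilon>. (vderiv ^^ j) (G \<epsilon>))"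
    by (rule bounded_O_cong) (use assms(2) in eventually_elim, simp)
qed

lemma smooth_O_cong':
  assumes "smooth_O k n F" "\<And>\<epsilon> x. \<epsilon> > 0 \<Longrightarrow> F \<epsilon> x = G \<epsilon> x"
  shows "smooth_O k n G"
proof (rule smooth_O_cong[OF assms(1)])
  show "\<forall>\<^sub>F \<epsilon> in at_right 0. F \<epsilon> = G \<epsilon>"
    using eventually_small[OF zero_less_one] by eventually_elim (auto simp: assms(2))
qed

lemma smooth_O_add:
  assumes "smooth_O k n F" "smooth_O k n G"
  shows "smooth_O k n (\<lambda>\<epsilon> x. F \<epsilon> x + G \<epsilon> x)"
  unfolding smooth_O_def
proof (intro conjI allI impI)
  note sm = smooth_O_smooth[OF assms(1)] smooth_O_smooth[OF assms(2)]
  show "\<forall>\<^sub>F \<epsilon> in at_right 0. smooth_on UNIV (\<lambda>x. F \<epsilon> x + G \<epsilon> x)"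
    using sm by eventually_elim (intro smooth_on_add open_UNIV)
  fix j assume "j \<le> k"
  hence "bounded_O n (\<lambda>\<epsilon> x. (vderiv ^^ j) (F \<epsilon>) x + (vderiv ^^ j) (G \<epsilon>) x)"
    using smooth_O_bounded assms by (intro bounded_O_add) blast+
  thus "bounded_O n (\<lambda>\<epsilon>. (vderiv ^^ j) (\<lambda>x. F \<epsilon> x + G \<epsilon> x))"
    by (rule bounded_O_cong) (use sm in eventually_elim, simp add: vderiv_funpow_add)
qed

lemma (in bounded_bilinear) smooth_O_prod:
  assumes "smooth_O k n F" "smooth_O k m G"
  shows "smooth_O k (n + m) (\<lambda>\<epsilon> x. prod (F \<epsilon> x) (G \<epsilon> x))"
  using assms
proof (induction k arbitrary: F G)
  case (0 F G)
  have "\<forall>\<^sub>F \<epsilon> in at_right 0. smooth_on UNIV (\<lambda>x. prod (F \<epsilon> x) (G \<epsilon> x))"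
    using smooth_O_smooth[OF 0(1)] smooth_O_smooth[OF 0(2)]
    by eventually_elim (intro smooth_on_prod open_UNIV)
  then show ?case using 0 by (simp add: smooth_O_0 bounded_O_prod)
next
  case (Suc k F G)
  note sm = smooth_O_smooth[OF Suc.prems(1)] smooth_O_smooth[OF Suc.prems(2)]
  have "smooth_O k (n + m) (\<lambda>\<epsilon> x. prod (F \<epsilon> x) (vderiv (G \<epsilon>) x) + prod (vderiv (F \<epsilon>) x) (G \<epsilon> x))"
    using Suc.prems by (intro smooth_O_add Suc.IH smooth_O_vderiv) (auto intro: smooth_O_lower)
  hence "smooth_O k (n + m) (\<lambda>\<epsilon>. vderiv (\<lambda>x. prod (F \<epsilon> x) (G \<epsilon> x)))"
    by (rule smooth_O_cong)
      (use sm in eventually_elim, auto intro!: ext vderiv_prod[symmetric] smooth_on_differentiable)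
  moreover have "\<forall>\<^sub>F \<epsilon> in at_right 0. smooth_on UNIV (\<lambda>x. prod (F \<epsilon> x) (G \<epsilon> x))"
    using sm by eventually_elim (intro smooth_on_prod open_UNIV)
  moreover have "bounded_O (n + m) (\<lambda>\<epsilon> x. prod (F \<epsilon> x) (G \<epsilon> x))"
    using Suc.prems by (intro bounded_O_prod) (auto simp: smooth_O_Suc)
  ultimately show ?case by (simp add: smooth_O_Suc)
qed

lemmas smooth_O_scaleR = bounded_bilinear.smooth_O_prod[OF bounded_bilinear_scaleR]
lemmas smooth_O_mult = bounded_bilinear.smooth_O_prod[OF bounded_bilinear_mult]
lemmas smooth_O_inner = bounded_bilinear.smooth_O_prod[OF bounded_bilinear_inner]

lemma bounded_O_const:
  assumes "continuous_on {0..1} f"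
  shows "bounded_O 0 (\<lambda>\<epsilon>. f)"
proof -
  have "compact (f ` {0..1})" using assms by (intro compact_continuous_image) auto
  hence "bounded (f ` {0..1})" by (rule compact_imp_bounded)
  then obtain C where "\<forall>x\<in>{0..1}. norm (f x) \<le> C" by (auto simp: bounded_iff)
  thus ?thesis unfolding bounded_O_def by (intro exI[of _ C]) auto
qed

lemma smooth_O_const: "smooth_on UNIV f \<Longrightarrow> smooth_O k 0 (\<lambda>\<epsilon>. f)"
  unfolding smooth_O_def
  by (auto intro!: bounded_O_const smooth_on_continuous smooth_on_UNIV[of _ "{0..1}"]
      smooth_on_vderiv_funpow)

lemma smooth_O_const_scaleR: "smooth_O k n F \<Longrightarrow> smooth_O k n (\<lambda>\<epsilon> x. c *\<^sub>R F \<epsilon> x)"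
  using smooth_O_scaleR[OF smooth_O_const[OF smooth_on_const[of _ c]], of k n F] by simp

lemma smooth_O_minus: "smooth_O k n F \<Longrightarrow> smooth_O k n (\<lambda>\<epsilon> x. - F \<epsilon> x)"
  using smooth_O_const_scaleR[of k n F "-1"] by simp

text \<open>One hypothesis covers multiplication and division by powers of \<epsilon>.\<close>

lemma smooth_O_scale:
  assumes "smooth_O k n F" "\<And>\<epsilon>. \<epsilon> > 0 \<Longrightarrow> \<bar>s \<epsilon>\<bar> * \<epsilon> ^ n = K * \<epsilon> ^ m"
  shows "smooth_O k m (\<lambda>\<epsilon> x. s \<epsilon> *\<^sub>R F \<epsilon> x)"
  unfolding smooth_O_def
proof (intro conjI allI impI)
  note sm = smooth_O_smooth[OF assms(1)]
  show "\<forall>\<^sub>F \<epsilon> in at_right 0. smooth_on UNIV (\<lambda>x. s \<epsilon> *\<^sub>R F \<epsilon> x)"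
    using sm by eventually_elim (intro smooth_on_scaleR_const open_UNIV)
  fix j assume "j \<le> k"
  then obtain C where "\<forall>\<^sub>F \<epsilon> in at_right 0. \<forall>x\<in>{0..1}. norm ((vderiv ^^ j) (F \<epsilon>) x) \<le> C * \<epsilon> ^ n"
    using assms(1) by (auto simp: smooth_O_def bounded_O_def)
  hence "\<forall>\<^sub>F \<epsilon> in at_right 0. \<forall>x\<in>{0..1}. norm ((vderiv ^^ j) (\<lambda>x. s \<epsilon> *\<^sub>R F \<epsilon> x) x) \<le> (C * K) * \<epsilon> ^ m"
    using sm eventually_small[OF zero_less_one]
  proof eventually_elim
    case (elim \<epsilon>)
    show ?case
    proof
      fix x :: real assume "x \<in> {0..1}"
      hence "\<bar>s \<epsilon>\<bar> * norm ((vderiv ^^ j) (F \<epsilon>) x) \<le> \<bar>s \<epsilon>\<bar> * (C * \<epsilon> ^ n)"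
        using elim by (intro mult_left_mono) auto
      also have "\<dots> = C * (\<bar>s \<epsilon>\<bar> * \<epsilon> ^ n)" by (simp only: mult_ac)
      finally show "norm ((vderiv ^^ j) (\<lambda>x. s \<epsilon> *\<^sub>R F \<epsilon> x) x) \<le> (C * K) * \<epsilon> ^ m"
        using elim by (simp add: vderiv_funpow_scaleR_const assms(2) mult.assoc)
    qed
  qed
  thus "bounded_O m (\<lambda>\<epsilon>. (vderiv ^^ j) (\<lambda>x. s \<epsilon> *\<^sub>R F \<epsilon> x))" unfolding bounded_O_def by blast
qed

lemma smooth_O_power_scaleR: "smooth_O k n F \<Longrightarrow> smooth_O k (n + m) (\<lambda>\<epsilon> x. \<epsilon> ^ m *\<^sub>R F \<epsilon> x)"
  by (rule smooth_O_scale[where K = 1]) (simp_all add: power_add mult.commute)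

lemma smooth_O_divide_power: "smooth_O k (n + m) F \<Longrightarrow> smooth_O k n (\<lambda>\<epsilon> x. (1 / \<epsilon> ^ m) *\<^sub>R F \<epsilon> x)"
  by (rule smooth_O_scale[where K = 1]) (auto simp: power_add)

lemma smooth_O_triple:
  assumes "smooth_O k n F" "smooth_O k m G" "smooth_O k p H"
  shows "smooth_O k (n + (m + p)) (\<lambda>\<epsilon> x. triple (F \<epsilon> x) (G \<epsilon> x) (H \<epsilon> x))"
  unfolding triple_cross by (intro smooth_O_inner cross3.smooth_O_prod assms)

text \<open>Telescoping: one factor is replaced at a time. Boundedness of the original factors
  follows from that of the approximations.\<close>

lemma smooth_O_triple_diff:
  assumes "smooth_O k n (\<lambda>\<epsilon> x. F \<epsilon> x - F' \<epsilon> x)" "smooth_O k n (\<lambda>\<epsilon> x. G \<epsilon> x - G' \<epsilon> x)"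
    and "smooth_O k n (\<lambda>\<epsilon> x. H \<epsilon> x - H' \<epsilon> x)"
    and "smooth_O k 0 F'" "smooth_O k 0 G'" "smooth_O k 0 H'"
  shows "smooth_O k n (\<lambda>\<epsilon> x. triple (F \<epsilon> x) (G \<epsilon> x) (H \<epsilon> x) - triple (F' \<epsilon> x) (G' \<epsilon> x) (H' \<epsilon> x))"
proof -
  have G: "smooth_O k 0 G"
    using smooth_O_add[OF smooth_O_mono[OF assms(2), of 0] assms(5)] by simp
  have H: "smooth_O k 0 H"
    using smooth_O_add[OF smooth_O_mono[OF assms(3), of 0] assms(6)] by simp
  have 1: "smooth_O k n (\<lambda>\<epsilon> x. triple (F \<epsilon> x - F' \<epsilon> x) (G \<epsilon> x) (H \<epsilon> x))"
    using smooth_O_triple[OF assms(1) G H] by simp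
  have 2: "smooth_O k n (\<lambda>\<epsilon> x. triple (F' \<epsilon> x) (G \<epsilon> x - G' \<epsilon> x) (H \<epsilon> x))"
    using smooth_O_triple[OF assms(4) assms(2) H] by simp
  have 3: "smooth_O k n (\<lambda>\<epsilon> x. triple (F' \<epsilon> x) (G' \<epsilon> x) (H \<epsilon> x - H' \<epsilon> x))"
    using smooth_O_triple[OF assms(4,5,3)] by simp
  show ?thesis using smooth_O_add[OF smooth_O_add[OF 1 2] 3] by simp
qed

text \<open>The derivative of a remainder in the step \<open>h\<close> is the remainder of
  \<open>vderiv f\<close> of one order less, so the mean value inequality, valid for vector values,
  raises the order. The constant is uniform for \<open>y\<close> and \<open>h\<close> in a compact
  interval.\<close>

lemma Taylor_bound:
  fixes f :: "real \<Rightarrow> 'a::real_normed_vector"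
  assumes "smooth_on UNIV f"
  shows "\<exists>C. \<forall>y h. \<bar>y\<bar> \<le> r \<longrightarrow> \<bar>h\<bar> \<le> r \<longrightarrow>
    norm (f (y + h) - (\<Sum>j<n. (h ^ j / fact j) *\<^sub>R (vderiv ^^ j) f y)) \<le> C * \<bar>h\<bar> ^ n"
  using assms
proof (induction n arbitrary: f)
  case 0
  have "continuous_on {-2*r..2*r} f" by (intro smooth_on_continuous smooth_on_UNIV[OF 0])
  hence "bounded (f ` {-2*r..2*r})" by (intro compact_imp_bounded compact_continuous_image) auto
  then obtain C where C: "\<forall>x\<in>{-2*r..2*r}. norm (f x) \<le> C" by (auto simp: bounded_iff)
  have "norm (f (y + h)) \<le> C" if "\<bar>y\<bar> \<le> r" "\<bar>h\<bar> \<le> r" for y h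
    using C that by (auto simp: abs_le_iff)
  thus ?case by (intro exI[of _ C]) simp
next
  case (Suc n f)
  obtain C where C: "\<And>y h. \<bar>y\<bar> \<le> r \<Longrightarrow> \<bar>h\<bar> \<le> r \<Longrightarrow>
    norm (vderiv f (y + h) - (\<Sum>j<n. (h ^ j / fact j) *\<^sub>R (vderiv ^^ Suc j) f y)) \<le> C * \<bar>h\<bar> ^ n"
    using Suc.IH[OF smooth_on_vderiv[OF Suc.prems]] unfolding vderiv_funpow_Suc by blast
  have "norm (f (y + h) - (\<Sum>j<Suc n. (h ^ j / fact j) *\<^sub>R (vderiv ^^ j) f y)) \<le> \<bar>C\<bar> * \<bar>h\<bar> ^ Suc n"
    if yh: "\<bar>y\<bar> \<le> r" "\<bar>h\<bar> \<le> r" for y h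
  proof -
    \<comment> \<open>The centre \<open>y\<close> stays fixed and the step varies. The constant term
      is split off so that the remaining summands differentiate to those of
      \<open>R'\<close>.\<close>
    define R where "R s = f (s + y) - (f y + (\<Sum>j<n. (s ^ Suc j / fact (Suc j)) *\<^sub>R (vderiv ^^ Suc j) f y))" for s
    define R' where "R' s = vderiv f (s + y) - (\<Sum>j<n. (s ^ j / fact j) *\<^sub>R (vderiv ^^ Suc j) f y)" for s
    have deriv: "(R has_vector_derivative R' s) (at s)" for s
    proof -
      have "((\<lambda>s. f (s + y)) has_vector_derivative vderiv f (s + y)) (at s)"
        by (intro has_vector_derivative_shift smooth_on_has_vderiv[OF Suc.prems]) auto
      moreover have "((\<lambda>s. (s ^ Suc j / fact (Suc j)) *\<^sub>R (vderiv ^^ Suc j) f y) has_vector_derivative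
          (s ^ j / fact j) *\<^sub>R (vderiv ^^ Suc j) f y) (at s)" for j
      proof -
        have "((\<lambda>s. s ^ Suc j / fact (Suc j)) has_real_derivative s ^ j / fact j) (at s)"
          using DERIV_cdivide[OF DERIV_pow[of "Suc j" s], of "fact (Suc j)"]
          by (simp del: of_nat_Suc power_Suc)
        from has_vector_derivative_scaleR[OF this has_vector_derivative_const]
        show ?thesis by simp
      qed
      ultimately have "(R has_vector_derivative vderiv f (s + y) -
          (0 + (\<Sum>j<n. (s ^ j / fact j) *\<^sub>R (vderiv ^^ Suc j) f y))) (at s)"
        unfolding R_def
        by (intro has_vector_derivative_diff has_vector_derivative_add has_vector_derivative_sum
            has_vector_derivative_const)
      thus ?thesis by (simp add: R'_def)
    qed
    have "norm (R h - R 0) \<le> (\<bar>C\<bar> * \<bar>h\<bar> ^ n) * norm (h - 0)"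
    proof (rule differentiable_bound)
      show "convex (closed_segment 0 h)" "h \<in> closed_segment 0 h" "0 \<in> closed_segment 0 h" by auto
      fix s assume "s \<in> closed_segment 0 h"
      hence s: "\<bar>s\<bar> \<le> \<bar>h\<bar>" by (auto simp: closed_segment_eq_real_ivl split: if_splits)
      show "(R has_derivative (\<lambda>x. x *\<^sub>R R' s)) (at s within closed_segment 0 h)"
        using deriv[of s] has_derivative_at_withinI by (auto simp: has_vector_derivative_def)
      have "norm (R' s) \<le> C * \<bar>s\<bar> ^ n"
        using C[of y s] s yh by (simp add: R'_def add.commute)
      also have "\<dots> \<le> \<bar>C\<bar> * \<bar>h\<bar> ^ n" using s by (intro mult_mono power_mono) auto
      finally show "onorm (\<lambda>x. x *\<^sub>R R' s) \<le> \<bar>C\<bar> * \<bar>h\<bar> ^ n"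
        by (simp add: onorm_scaleR_left bounded_linear_ident onorm_id)
    qed
    moreover have "R 0 = 0" by (simp add: R_def)
    moreover have "R h = f (y + h) - (\<Sum>j<Suc n. (h ^ j / fact j) *\<^sub>R (vderiv ^^ j) f y)"
      by (simp only: R_def sum.lessThan_Suc_shift add.commute[of h]) simp
    ultimately show ?thesis by (simp add: mult_ac)
  qed
  thus ?case by blast
qed

text \<open>Differentiating in \<open>x\<close> commutes with all operations, so the derivative of
  the remainder is the remainder of \<open>vderiv f\<close>. The centre may move with \<epsilon>:
  weights of the chord are expanded around one end point, where terms of the expansion
  cancel.\<close>

lemma smooth_O_Taylor:
  assumes "smooth_on UNIV f"
  shows "smooth_O k n (\<lambda>\<epsilon> x. f (x + a * \<epsilon>) -
    (\<Sum>j<n. (((a - b) * \<epsilon>) ^ j / fact j) *\<^sub>R (vderiv ^^ j) f (x + b * \<epsilon>)))"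
  using assms
proof (induction k arbitrary: f)
  have bound: "bounded_O n (\<lambda>\<epsilon> x. f (x + a * \<epsilon>) -
      (\<Sum>j<n. (((a - b) * \<epsilon>) ^ j / fact j) *\<^sub>R (vderiv ^^ j) f (x + b * \<epsilon>)))"
    if f: "smooth_on UNIV f" for f :: "real \<Rightarrow> 'a"
  proof -
    let ?r = "1 + \<bar>a\<bar> + \<bar>b\<bar>"
    obtain C where C: "\<And>y h. \<bar>y\<bar> \<le> ?r \<Longrightarrow> \<bar>h\<bar> \<le> ?r \<Longrightarrow>
      norm (f (y + h) - (\<Sum>j<n. (h ^ j / fact j) *\<^sub>R (vderiv ^^ j) f y)) \<le> C * \<bar>h\<bar> ^ n"
      using Taylor_bound[OF f] by blast
    have "\<forall>\<^sub>F \<epsilon> in at_right 0. \<forall>x\<in>{0..1}. norm (f (x + a * \<epsilon>) -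
      (\<Sum>j<n. (((a - b) * \<epsilon>) ^ j / fact j) *\<^sub>R (vderiv ^^ j) f (x + b * \<epsilon>))) \<le> (C * \<bar>a - b\<bar> ^ n) * \<epsilon> ^ n"
      using eventually_small[OF zero_less_one]
    proof eventually_elim
      case (elim \<epsilon>)
      show ?case
      proof
        fix x :: real assume x: "x \<in> {0..1}"
        have "\<bar>b * \<epsilon>\<bar> \<le> \<bar>b\<bar> * 1" "\<bar>(a - b) * \<epsilon>\<bar> \<le> \<bar>a - b\<bar> * 1"
          unfolding abs_mult using elim by (intro mult_left_mono; simp)+
        hence "\<bar>x + b * \<epsilon>\<bar> \<le> ?r" "\<bar>(a - b) * \<epsilon>\<bar> \<le> ?r" using x by auto
        moreover have "x + b * \<epsilon> + (a - b) * \<epsilon> = x + a * \<epsilon>" by (simp add: algebra_simps)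
        moreover have "\<bar>(a - b) * \<epsilon>\<bar> ^ n = \<bar>a - b\<bar> ^ n * \<epsilon> ^ n"
          using elim by (simp add: abs_mult power_mult_distrib)
        ultimately show "norm (f (x + a * \<epsilon>) -
            (\<Sum>j<n. (((a - b) * \<epsilon>) ^ j / fact j) *\<^sub>R (vderiv ^^ j) f (x + b * \<epsilon>))) \<le> (C * \<bar>a - b\<bar> ^ n) * \<epsilon> ^ n"
          using C[of "x + b * \<epsilon>" "(a - b) * \<epsilon>"] by (simp only: mult.assoc)
      qed
    qed
    thus ?thesis unfolding bounded_O_def by blast
  qed
  have smooth: "smooth_on UNIV (\<lambda>x. f (x + a * \<epsilon>) -
      (\<Sum>j<n. (((a - b) * \<epsilon>) ^ j / fact j) *\<^sub>R (vderiv ^^ j) f (x + b * \<epsilon>)))"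
    if "smooth_on UNIV f" for f :: "real \<Rightarrow> 'a" and \<epsilon>
    using that by (intro smooth_on_diff smooth_on_sum smooth_on_scaleR_const smooth_on_shift
        smooth_on_vderiv_funpow open_UNIV)
  {
    case 0
    then show ?case using bound smooth by (simp add: smooth_O_0)
  next
    case (Suc k f)
    have diff: "(\<lambda>x. (vderiv ^^ j) f (x + c)) differentiable (at x)" for j c x
      using Suc.prems by (intro smooth_on_differentiable[of UNIV] smooth_on_shift smooth_on_vderiv_funpow) auto
    have "vderiv (\<lambda>x. f (x + a * \<epsilon>) -
        (\<Sum>j<n. (((a - b) * \<epsilon>) ^ j / fact j) *\<^sub>R (vderiv ^^ j) f (x + b * \<epsilon>))) =
      (\<lambda>x. vderiv f (x + a * \<epsilon>) -
        (\<Sum>j<n. (((a - b) * \<epsilon>) ^ j / fact j) *\<^sub>R (vderiv ^^ j) (vderiv f) (x + b * \<epsilon>)))" for \<epsilon>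
    proof
      fix x
      show "vderiv (\<lambda>x. f (x + a * \<epsilon>) -
        (\<Sum>j<n. (((a - b) * \<epsilon>) ^ j / fact j) *\<^sub>R (vderiv ^^ j) f (x + b * \<epsilon>))) x =
        vderiv f (x + a * \<epsilon>) -
        (\<Sum>j<n. (((a - b) * \<epsilon>) ^ j / fact j) *\<^sub>R (vderiv ^^ j) (vderiv f) (x + b * \<epsilon>))"
        using diff[of 0] diff
        by (subst vderiv_diff vderiv_sum vderiv_scaleR_const vderiv_shift;
            (intro differentiable_sum differentiable_scaleR)?; simp add: vderiv_shift flip: vderiv_funpow_Suc)+
    qed
    then show ?case using Suc bound smooth by (simp add: smooth_O_Suc smooth_on_vderiv)
  }
qed

text \<open>With f the inverse cube root, f - 1 divides f^3 - 1 = (1 - d) / d with a cofactor of at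
  least 1; the constant 2 bounds 1 / d.\<close>

lemma inverse_cbrt_bound:
  assumes "\<bar>d - 1\<bar> \<le> 1 / 2"
  shows "\<bar>d powr (- 1/3) - 1\<bar> \<le> 2 * \<bar>d - 1 :: real\<bar>"
proof -
  have d: "d \<ge> 1 / 2" using assms by linarith
  define f where "f = d powr (- 1/3)"
  have f: "f > 0" "f ^ 3 * d = 1" using d inverse_cbrt_cube[of d] by (auto simp: f_def)
  have "\<bar>f - 1\<bar> * 1 \<le> \<bar>f - 1\<bar> * (f\<^sup>2 + f + 1)" using f by (intro mult_left_mono) auto
  also have "\<dots> = \<bar>(f - 1) * (f\<^sup>2 + f + 1)\<bar>" using f by (simp add: abs_mult)
  also have "(f - 1) * (f\<^sup>2 + f + 1) = f ^ 3 - 1" by (simp add: power2_eq_square power3_eq_cube algebra_simps)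
  also have "\<bar>f ^ 3 - 1\<bar> * d = \<bar>d - 1\<bar>" 
  proof -
    have "\<bar>f ^ 3 - 1\<bar> * d = \<bar>(f ^ 3 - 1) * d\<bar>" using d by (simp add: abs_mult)
    also have "(f ^ 3 - 1) * d = 1 - d" using f by (simp add: algebra_simps)
    finally show ?thesis by simp
  qed
  hence "\<bar>f ^ 3 - 1\<bar> = \<bar>d - 1\<bar> / d" using d by (simp add: field_simps)
  also have "\<dots> \<le> \<bar>d - 1\<bar> / (1 / 2)" using d by (intro divide_left_mono) auto
  finally show ?thesis by (simp add: f_def)
qed

text \<open>Only the function itself needs the Lipschitz estimate. Derivatives are bounded
  inductively, as the derivative is a fourth power already known to be bounded times the derivative
  of \<open>D\<close>, which has the required order.\<close>

lemma smooth_O_inverse_cbrt: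
  fixes D :: "real \<Rightarrow> real \<Rightarrow> real"
  assumes D: "\<And>k. smooth_O k n (\<lambda>\<epsilon> x. D \<epsilon> x - 1)" and "n > 0"
    and pos: "\<forall>\<^sub>F \<epsilon> in at_right 0. \<forall>x. D \<epsilon> x > 0"
  shows "smooth_O k n (\<lambda>\<epsilon> x. D \<epsilon> x powr (- 1/3) - 1)"
proof -
  have sm: "\<forall>\<^sub>F \<epsilon> in at_right 0. smooth_on UNIV (D \<epsilon>)"
    using smooth_O_smooth[OF D[of 0]]
    by eventually_elim (use smooth_on_add[OF _ _ smooth_on_const[of _ 1]] in fastforce)
  have sm': "\<forall>\<^sub>F \<epsilon> in at_right 0. smooth_on UNIV (\<lambda>x. D \<epsilon> x powr (- 1/3) - 1)"
    using sm pos by eventually_elim (intro smooth_on_diff smooth_on_inverse_cbrt smooth_on_const open_UNIV; simp)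
  obtain C where C: "C \<ge> 0" "\<forall>\<^sub>F \<epsilon> in at_right 0. \<forall>x\<in>{0..1}. norm (D \<epsilon> x - 1) \<le> C * \<epsilon> ^ n"
    using smooth_O_bounded[OF D[of 0], of 0] by (auto elim: bounded_OE)
  \<comment> \<open>Below this threshold \<open>D\<close> stays within 1/2 of 1 on the unit
    interval; adding 1 allows \<open>C\<close> = 0.\<close>
  have c: "1 / (2 * (C + 1)) > 0" using C by simp
  have "\<forall>\<^sub>F \<epsilon> in at_right 0. \<forall>x\<in>{0..1}. norm (D \<epsilon> x powr (- 1/3) - 1) \<le> (2 * C) * \<epsilon> ^ n"
    using C(2) eventually_small[OF zero_less_one] eventually_small[OF c]
  proof eventually_elim
    case (elim \<epsilon>)
    have "\<epsilon> ^ n \<le> \<epsilon> ^ 1" using elim \<open>n > 0\<close> by (intro power_decreasing) auto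
    hence "C * \<epsilon> ^ n \<le> (C + 1) * \<epsilon>" using C elim by (intro mult_mono) auto
    also have "\<dots> \<le> 1 / 2" using elim C(1) by (simp add: field_simps)
    finally have le: "C * \<epsilon> ^ n \<le> 1 / 2" .
    show ?case
    proof
      fix x :: real assume "x \<in> {0..1}"
      hence d: "\<bar>D \<epsilon> x - 1\<bar> \<le> C * \<epsilon> ^ n" using elim(1) by simp
      hence "\<bar>D \<epsilon> x powr (- 1/3) - 1\<bar> \<le> 2 * \<bar>D \<epsilon> x - 1\<bar>"
        using le by (intro inverse_cbrt_bound) linarith
      thus "norm (D \<epsilon> x powr (- 1/3) - 1) \<le> (2 * C) * \<epsilon> ^ n" using d by simp
    qed
  qed
  hence bound: "bounded_O n (\<lambda>\<epsilon> x. D \<epsilon> x powr (- 1/3) - 1)" unfolding bounded_O_def by blast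
  show ?thesis
  proof (induction k)
    case 0
    show ?case using sm' bound by (simp add: smooth_O_0)
  next
    case (Suc k)
    have "smooth_O k 0 (\<lambda>\<epsilon> x. (D \<epsilon> x powr (- 1/3) - 1) + 1)"
      using Suc by (intro smooth_O_add smooth_O_const smooth_on_const) (auto intro: smooth_O_mono)
    hence f: "smooth_O k 0 (\<lambda>\<epsilon> x. D \<epsilon> x powr (- 1/3))" by simp
    have pow: "smooth_O k 0 (\<lambda>\<epsilon> x. (D \<epsilon> x powr (- 1/3)) ^ j)" for j
    proof (induction j)
      case (Suc j)
      show ?case using smooth_O_mult[OF f Suc] by simp
    qed (simp add: smooth_O_const)
    have "smooth_O k n (\<lambda>\<epsilon>. vderiv (\<lambda>x. D \<epsilon> x - 1))" by (rule smooth_O_vderiv[OF D])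
    hence "smooth_O k n (\<lambda>\<epsilon> x. (- 1/3) *\<^sub>R vderiv (\<lambda>x. D \<epsilon> x - 1) x)" by (rule smooth_O_const_scaleR)
    from smooth_O_mult[OF pow[of 4] this]
    have "smooth_O k n (\<lambda>\<epsilon> x. (D \<epsilon> x powr (- 1/3)) ^ 4 * ((- 1/3) *\<^sub>R vderiv (\<lambda>x. D \<epsilon> x - 1) x))"
      by simp
    hence "smooth_O k n (\<lambda>\<epsilon>. vderiv (\<lambda>x. D \<epsilon> x powr (- 1/3) - 1))"
    proof (rule smooth_O_cong)
      show "\<forall>\<^sub>F \<epsilon> in at_right 0. (\<lambda>x. (D \<epsilon> x powr (- 1/3)) ^ 4 * ((- 1/3) *\<^sub>R vderiv (\<lambda>x. D \<epsilon> x - 1) x)) =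
          vderiv (\<lambda>x. D \<epsilon> x powr (- 1/3) - 1)"
        using sm pos
      proof eventually_elim
        case (elim \<epsilon>)
        have d: "D \<epsilon> differentiable (at x)" for x
          using elim(1) by (rule smooth_on_differentiable) simp
        have "((\<lambda>x. D \<epsilon> x powr (- 1/3) - 1) has_vector_derivative
            (D \<epsilon> x powr (- 1/3)) ^ 4 * (- vderiv (D \<epsilon>) x / 3) - 0) (at x)" for x
          using elim d by (intro has_vector_derivative_diff has_vderiv_inverse_cbrt has_vector_derivative_const) auto
        from vderiv_eqI[OF this] show ?case using d by (auto simp: vderiv_diff)
      qed
    qed
    thus ?case using sm' bound by (simp add: smooth_O_Suc)
  qed
qed

section \<open>The envelope of the chords\<close>

text \<open>Differentiating term by term costs one controlled derivative but no power of
  \<epsilon>.\<close>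

lemma smooth_O_vderiv_expansion:
  assumes "smooth_on UNIV p" "smooth_on UNIV q"
    and "smooth_O (Suc k) n (\<lambda>\<epsilon> x. F \<epsilon> x - (p x + \<epsilon>\<^sup>2 *\<^sub>R q x))"
  shows "smooth_O k n (\<lambda>\<epsilon> x. vderiv (F \<epsilon>) x - (vderiv p x + \<epsilon>\<^sup>2 *\<^sub>R vderiv q x))"
proof (rule smooth_O_cong[OF smooth_O_vderiv[OF assms(3)]])
  have s: "smooth_on UNIV (\<lambda>x. p x + \<epsilon>\<^sup>2 *\<^sub>R q x)" for \<epsilon>
    by (intro smooth_on_add smooth_on_scaleR_const open_UNIV assms)
  have d: "vderiv (\<lambda>x. p x + \<epsilon>\<^sup>2 *\<^sub>R q x) x = vderiv p x + \<epsilon>\<^sup>2 *\<^sub>R vderiv q x" for \<epsilon> x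
    using assms(1,2)[THEN smooth_on_differentiable, of x]
    by (simp add: vderiv_add vderiv_scaleR_const)
  show "\<forall>\<^sub>F \<epsilon> in at_right 0. vderiv (\<lambda>x. F \<epsilon> x - (p x + \<epsilon>\<^sup>2 *\<^sub>R q x)) =
    (\<lambda>x. vderiv (F \<epsilon>) x - (vderiv p x + \<epsilon>\<^sup>2 *\<^sub>R vderiv q x))"
    using smooth_O_smooth[OF assms(3)]
  proof eventually_elim
    case (elim \<epsilon>)
    have "smooth_on UNIV (F \<epsilon>)" using smooth_on_add[OF open_UNIV elim s[of \<epsilon>]] by simp
    hence "F \<epsilon> differentiable (at x)" for x by (rule smooth_on_differentiable) simp
    thus ?case
      using smooth_on_differentiable[OF s[of \<epsilon>]] by (simp add: fun_eq_iff vderiv_diff d)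
  qed
qed

lemma smooth_O_expansion_bounded:
  assumes "smooth_on UNIV p" "smooth_on UNIV q"
  shows "smooth_O k 0 (\<lambda>\<epsilon> x. p x + \<epsilon>\<^sup>2 *\<^sub>R q x)"
proof -
  have "smooth_O k (0 + 2) (\<lambda>\<epsilon> x. \<epsilon>\<^sup>2 *\<^sub>R q x)"
    by (intro smooth_O_power_scaleR smooth_O_const assms)
  hence "smooth_O k 0 (\<lambda>\<epsilon> x. \<epsilon>\<^sup>2 *\<^sub>R q x)" by (rule smooth_O_mono) simp
  thus ?thesis by (intro smooth_O_add smooth_O_const assms)
qed

text \<open>Cramer's rule in the basis \<open>a\<close>, \<open>b\<close>, \<open>n\<close>, where
  the hypothesis removes the component along \<open>n\<close>.\<close>

lemma span_pair_triple_conv: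
  assumes "triple a b n \<noteq> 0" "triple a b z = 0"
  shows "z \<in> span {a, b}"
proof -
  have "triple a b n *\<^sub>R z = triple z b n *\<^sub>R a + triple a z n *\<^sub>R b"
    using triple_Cramer[of a b n z] assms(2) by simp
  hence "z = inverse (triple a b n) *\<^sub>R (triple z b n *\<^sub>R a + triple a z n *\<^sub>R b)"
    using assms(1) by (metis scaleR_one scaleR_scaleR left_inverse)
  also have "\<dots> \<in> span {a, b}" by (intro span_scale span_add span_base) auto
  finally show ?thesis .
qed

text \<open>The projective curve is replaced by its lift, whose monodromy is linear. Periodicity of
  \<open>u\<close> makes the normalizing factor of the envelope periodic.\<close>

locale lifted_curve =
  fixes f :: "real \<Rightarrow> real^3" and u v :: "real \<Rightarrow> real" and A :: "real^3^3"
  assumes smooth [simp]: "smooth_on UNIV f" "smooth_on UNIV u" "smooth_on UNIV v"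
    and W: "wronskian f x = 1"
    and ode: "(vderiv ^^ 3) f x + u x *\<^sub>R vderiv f x + v x *\<^sub>R f x = 0"
    and monodromy: "f (x + 1) = A *v f x"
    and periodic: "u (x + 1) = u x"
begin

abbreviation f1 where "f1 \<equiv> vderiv f"
abbreviation f2 where "f2 \<equiv> vderiv f1"
abbreviation u1 where "u1 \<equiv> vderiv u"
abbreviation u2 where "u2 \<equiv> vderiv u1"
abbreviation u3 where "u3 \<equiv> vderiv u2"
abbreviation v1 where "v1 \<equiv> vderiv v"
abbreviation v2 where "v2 \<equiv> vderiv v1"

lemma smooth' [simp]:
  "smooth_on UNIV f1" "smooth_on UNIV f2" "smooth_on UNIV u1" "smooth_on UNIV u2" "smooth_on UNIV u3"
  "smooth_on UNIV v1" "smooth_on UNIV v2"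
  by (simp_all add: smooth_on_vderiv)

lemma diff [simp]:
  "f differentiable (at x)" "f1 differentiable (at x)" "f2 differentiable (at x)"
  "u differentiable (at x)" "u1 differentiable (at x)" "u2 differentiable (at x)"
  "v differentiable (at x)" "v1 differentiable (at x)"
  by (rule smooth_on_differentiable[of UNIV]; simp)+

lemma vderiv_f2: "vderiv f2 x = - u x *\<^sub>R f1 x - v x *\<^sub>R f x"
  using ode[of x] by (simp add: vderiv_3 algebra_simps eq_neg_iff_add_eq_0)

lemma triple_f:
  "triple (f x) (f1 x) (f2 x) = 1" "triple (f x) (f2 x) (f1 x) = - 1"
  "triple (f1 x) (f x) (f2 x) = - 1" "triple (f1 x) (f2 x) (f x) = 1"
  "triple (f2 x) (f x) (f1 x) = 1" "triple (f2 x) (f1 x) (f x) = - 1"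
  using W[of x] by (simp_all add: wronskian_def triple_cross cross3_simps)

definition frame :: "(real \<Rightarrow> real) \<Rightarrow> (real \<Rightarrow> real) \<Rightarrow> (real \<Rightarrow> real) \<Rightarrow> real \<Rightarrow> real^3" where
  "frame a b c x = a x *\<^sub>R f x + b x *\<^sub>R f1 x + c x *\<^sub>R f2 x"

lemma smooth_on_frame:
  "smooth_on UNIV a \<Longrightarrow> smooth_on UNIV b \<Longrightarrow> smooth_on UNIV c \<Longrightarrow> smooth_on UNIV (frame a b c)"
  unfolding frame_def[abs_def] by (intro smooth_on_add smooth_on_scaleR open_UNIV) simp_all

text \<open>The differential equation eliminates f''', so derivatives keep coordinates in the moving
  frame f, f', f'' and identities become comparisons of scalars.\<close>

lemma vderiv_frame:
  assumes "a differentiable (at x)" "b differentiable (at x)" "c differentiable (at x)"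
  shows "vderiv (frame a b c) x = (vderiv a x - v x * c x) *\<^sub>R f x
    + (a x + vderiv b x - u x * c x) *\<^sub>R f1 x + (b x + vderiv c x) *\<^sub>R f2 x"
proof -
  have "(frame a b c has_vector_derivative
      (a x *\<^sub>R f1 x + vderiv a x *\<^sub>R f x) + (b x *\<^sub>R f2 x + vderiv b x *\<^sub>R f1 x)
      + (c x *\<^sub>R vderiv f2 x + vderiv c x *\<^sub>R f2 x)) (at x)"
    unfolding frame_def[abs_def] using assms
    by (intro has_vector_derivative_add bounded_bilinear.has_vector_derivative[OF bounded_bilinear_scaleR]
        has_vderiv) auto
  from vderiv_eqI[OF this] show ?thesis
    by (simp add: vderiv_f2 vec_eq_iff algebra_simps)
qed

text \<open>f''/2 is the second-order part of the mean of f(x + \<epsilon>) and f(x - \<epsilon>).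
  Adding \<phi> f changes the Wronskian to first order in \<open>\<epsilon>\<^sup>2\<close> by
  \<phi> + (\<phi> - u/2) + (\<phi> - u/2), which vanishes exactly for \<phi> = u/3.\<close>

definition H :: "real \<Rightarrow> real^3" where
  "H = frame (\<lambda>x. u x / 3) (\<lambda>x. 0) (\<lambda>x. 1 / 2)"
definition H1 :: "real \<Rightarrow> real^3" where
  "H1 = frame (\<lambda>x. u1 x / 3 - v x / 2) (\<lambda>x. - u x / 6) (\<lambda>x. 0)"
definition H2 :: "real \<Rightarrow> real^3" where
  "H2 = frame (\<lambda>x. u2 x / 3 - v1 x / 2) (\<lambda>x. u1 x / 6 - v x / 2) (\<lambda>x. - u x / 6)"
definition H3 :: "real \<Rightarrow> real^3" where
  "H3 = frame (\<lambda>x. u3 x / 3 - v2 x / 2 + u x * v x / 6) (\<lambda>x. u2 x / 2 - v1 x + (u x)\<^sup>2 / 6) (\<lambda>x. - v x / 2)"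

lemma vderiv_divide: "g differentiable (at x) \<Longrightarrow> vderiv (\<lambda>x. g x / c) x = vderiv g x / (c :: real)"
  using vderiv_scaleR_const[of g x "inverse c"] by (simp add: divide_inverse mult.commute)

lemma diff_divide: "g differentiable (at x) \<Longrightarrow> (\<lambda>x. g x / c) differentiable (at x)" for g :: "real \<Rightarrow> real" and c
  unfolding divide_inverse by (intro differentiable_mult) auto

lemmas vderivs = vderiv_divide vderiv_diff vderiv_add vderiv_minus diff_divide

lemma vderiv_H: "vderiv H = H1" "vderiv H1 = H2" "vderiv H2 = H3"
  by (rule ext, simp add: H_def H1_def H2_def H3_def vderiv_frame vderivs differentiable_diff
      differentiable_minus frame_def algebra_simps power2_eq_square)+

lemma smooth_H [simp]: "smooth_on UNIV H" "smooth_on UNIV H1" "smooth_on UNIV H2" "smooth_on UNIV H3"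
proof -
  show "smooth_on UNIV H" unfolding H_def
    by (intro smooth_on_frame smooth_on_divide_const open_UNIV) simp_all
  thus "smooth_on UNIV H1" "smooth_on UNIV H2" "smooth_on UNIV H3"
    unfolding vderiv_H[symmetric] by (simp_all add: smooth_on_vderiv)
qed

text \<open>For \<open>s\<close> = 1 and \<open>s\<close> = -1 this is the weight of f(x +
  \<epsilon>) and of f(x - \<epsilon>). The arguments have the shape required by
  \<open>smooth_O_Taylor\<close>.\<close>

definition coeff :: "real \<Rightarrow> real \<Rightarrow> real \<Rightarrow> real" where
  "coeff s \<epsilon> x = triple (f (x + (- s) * \<epsilon>)) (f1 (x + (- s) * \<epsilon>)) (f (x + s * \<epsilon>))"

text \<open>The second end point is expanded around the first, at step 2s\<epsilon>. The components
  along f and f' cancel, f'' gives (2\<epsilon>)^2/2, f''' has no component along f'', and the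
  fourth derivative gives -u (2\<epsilon>)^4/24. Only even powers of \<open>s\<close> occur.\<close>

lemma coeff_expansion:
  assumes "s\<^sup>2 = 1"
  shows "smooth_O k 5 (\<lambda>\<epsilon> x. coeff s \<epsilon> x - (2 * \<epsilon>\<^sup>2 - 2/3 * \<epsilon> ^ 4 * u x))"
proof -
  define P where "P \<epsilon> x = (\<Sum>j<5. (((s - (- s)) * \<epsilon>) ^ j / fact j) *\<^sub>R (vderiv ^^ j) f (x + (- s) * \<epsilon>))" for \<epsilon> x
  have bounded: "smooth_O k 0 (\<lambda>\<epsilon> x. g (x + c * \<epsilon>))" if "smooth_on UNIV g" for g :: "real \<Rightarrow> real^3" and c
    using smooth_O_Taylor[OF that, of k 0 c 0] by simp
  have "smooth_O k (0 + (0 + 5)) (\<lambda>\<epsilon> x. triple (f (x + (- s) * \<epsilon>)) (f1 (x + (- s) * \<epsilon>)) (f (x + s * \<epsilon>) - P \<epsilon> x))"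
    unfolding P_def by (intro smooth_O_triple smooth_O_Taylor bounded) simp_all
  hence 1: "smooth_O k 5 (\<lambda>\<epsilon> x. coeff s \<epsilon> x - triple (f (x + (- s) * \<epsilon>)) (f1 (x + (- s) * \<epsilon>)) (P \<epsilon> x))"
    by (simp add: coeff_def)
  have f4: "(vderiv ^^ 4) f x = - u x *\<^sub>R f2 x - (u1 x + v x) *\<^sub>R f1 x - v1 x *\<^sub>R f x" for x
  proof -
    have "(vderiv ^^ 4) f x = vderiv (frame (\<lambda>x. - v x) (\<lambda>x. - u x) (\<lambda>x. 0)) x"
      by (simp add: eval_nat_numeral vderiv_f2[abs_def] frame_def[abs_def])
    also have "\<dots> = - u x *\<^sub>R f2 x - (u1 x + v x) *\<^sub>R f1 x - v1 x *\<^sub>R f x"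
      by (simp add: vderiv_frame vderiv_minus differentiable_minus vec_eq_iff algebra_simps)
    finally show ?thesis .
  qed
  have s4: "s ^ 4 = 1" using assms by (simp add: power4_eq_xxxx power2_eq_square)
  have P: "triple (f (x + (- s) * \<epsilon>)) (f1 (x + (- s) * \<epsilon>)) (P \<epsilon> x) =
      2 * \<epsilon>\<^sup>2 - 2/3 * \<epsilon> ^ 4 * u (x + (- s) * \<epsilon>)" for \<epsilon> x
  proof -
    let ?y = "x + (- s) * \<epsilon>"
    have "P \<epsilon> x = (((2 * s * \<epsilon>) ^ 0) / 1) *\<^sub>R f ?y + ((2 * s * \<epsilon>) ^ 1 / 1) *\<^sub>R f1 ?y + ((2 * s * \<epsilon>) ^ 2 / 2) *\<^sub>R f2 ?y
        + ((2 * s * \<epsilon>) ^ 3 / 6) *\<^sub>R vderiv f2 ?y + ((2 * s * \<epsilon>) ^ 4 / 24) *\<^sub>R (vderiv ^^ 4) f ?y"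
      by (simp add: P_def eval_nat_numeral fact_numeral algebra_simps)
    hence "triple (f ?y) (f1 ?y) (P \<epsilon> x) = (2 * s * \<epsilon>) ^ 2 / 2 - (2 * s * \<epsilon>) ^ 4 / 24 * u ?y"
      by (simp only: triple_simps triple_f f4 vderiv_f2) simp
    also have "\<dots> = 2 * \<epsilon>\<^sup>2 - 2/3 * \<epsilon> ^ 4 * u ?y"
      using assms s4 by (simp add: power_mult_distrib)
    finally show ?thesis .
  qed
  \<comment> \<open>Moving \<open>u\<close> from the end point to \<open>x\<close> costs one power
    of \<epsilon>, which the factor \<epsilon>^4 turns into order 5.\<close>
  have "smooth_O k 1 (\<lambda>\<epsilon> x. u (x + (- s) * \<epsilon>) - u x)"
    using smooth_O_Taylor[of u k 1 "- s" 0] by simp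
  hence "smooth_O k (1 + 4) (\<lambda>\<epsilon> x. \<epsilon> ^ 4 *\<^sub>R ((- 2/3) *\<^sub>R (u (x + (- s) * \<epsilon>) - u x)))"
    by (intro smooth_O_power_scaleR smooth_O_const_scaleR)
  hence 2: "smooth_O k 5 (\<lambda>\<epsilon> x. \<epsilon> ^ 4 *\<^sub>R ((- 2/3) *\<^sub>R (u (x + (- s) * \<epsilon>) - u x)))" by simp
  show ?thesis
    by (rule smooth_O_cong'[OF smooth_O_add[OF 1 2]]) (simp only: P, simp add: algebra_simps)
qed

definition raw_envelope :: "real \<Rightarrow> real \<Rightarrow> real^3" where
  "raw_envelope \<epsilon> x = coeff 1 \<epsilon> x *\<^sub>R f (x + 1 * \<epsilon>) + coeff (- 1) \<epsilon> x *\<^sub>R f (x + (- 1) * \<epsilon>)"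

text \<open>The factor is chosen so that the Wronskian becomes \<open>1 + O(\<epsilon>\<^sup>3)\<close>.\<close>

definition envelope :: "real \<Rightarrow> real \<Rightarrow> real^3" where
  "envelope \<epsilon> x = ((1 + 2/3 * \<epsilon>\<^sup>2 * u x) / (4 * \<epsilon>\<^sup>2)) *\<^sub>R raw_envelope \<epsilon> x"

lemma smooth_on_coeff: "smooth_on UNIV (coeff s \<epsilon>)"
  unfolding coeff_def[abs_def] by (intro smooth_on_triple smooth_on_shift open_UNIV) simp_all

lemma smooth_on_raw_envelope: "smooth_on UNIV (raw_envelope \<epsilon>)"
  unfolding raw_envelope_def[abs_def]
  by (intro smooth_on_add smooth_on_scaleR smooth_on_coeff smooth_on_shift open_UNIV smooth)

lemma smooth_on_factor: "smooth_on UNIV (\<lambda>x. (1 + 2/3 * \<epsilon>\<^sup>2 * u x) / (4 * \<epsilon>\<^sup>2))"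
  by (intro smooth_on_divide_const smooth_on_add smooth_on_mult open_UNIV smooth smooth_on_const)

lemma smooth_on_envelope: "smooth_on UNIV (envelope \<epsilon>)"
  unfolding envelope_def[abs_def]
  by (intro smooth_on_scaleR smooth_on_factor smooth_on_raw_envelope open_UNIV)

text \<open>The weights agree up to order 5, so both may be replaced by their common expansion of
  order 2. The odd terms of the two end points then cancel, and the symmetric sum is needed only up
  to order 3.\<close>

lemma raw_envelope_expansion:
  "smooth_O k 5 (\<lambda>\<epsilon> x. raw_envelope \<epsilon> x - (2 * \<epsilon>\<^sup>2 - 2/3 * \<epsilon> ^ 4 * u x) *\<^sub>R (2 *\<^sub>R f x + \<epsilon>\<^sup>2 *\<^sub>R f2 x))"
proof -
  define Q where "Q \<epsilon> x = 2 * \<epsilon>\<^sup>2 - 2/3 * \<epsilon> ^ 4 * u x" for \<epsilon> x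
  have bounded: "smooth_O k 0 (\<lambda>\<epsilon> x. f (x + c * \<epsilon>))" for c
    using smooth_O_Taylor[OF smooth(1), of k 0 c 0] by simp
  have 1: "smooth_O k 5 (\<lambda>\<epsilon> x. (coeff s \<epsilon> x - Q \<epsilon> x) *\<^sub>R f (x + s * \<epsilon>))" if "s\<^sup>2 = 1" for s
    using smooth_O_scaleR[OF coeff_expansion[OF that] bounded] by (simp add: Q_def)
  have "smooth_O k (0 + 2) (\<lambda>\<epsilon> x. \<epsilon>\<^sup>2 *\<^sub>R (2 :: real))" "smooth_O k (0 + 4) (\<lambda>\<epsilon> x. \<epsilon> ^ 4 *\<^sub>R (- 2/3 * u x))"
    by (intro smooth_O_power_scaleR smooth_O_const smooth_on_mult smooth_on_const smooth open_UNIV)+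
  hence "smooth_O k 2 (\<lambda>\<epsilon> x. \<epsilon>\<^sup>2 *\<^sub>R (2 :: real) + \<epsilon> ^ 4 *\<^sub>R (- 2/3 * u x))"
    by (intro smooth_O_add) (auto intro: smooth_O_mono)
  hence Q: "smooth_O k 2 Q"
    by (rule smooth_O_cong') (simp add: Q_def)
  have T: "smooth_O k 3 (\<lambda>\<epsilon> x. f (x + s * \<epsilon>) - (f x + (s * \<epsilon>) *\<^sub>R f1 x + ((s * \<epsilon>)\<^sup>2 / 2) *\<^sub>R f2 x))" for s
    using smooth_O_Taylor[OF smooth(1), of k 3 s 0]
    by (simp add: eval_nat_numeral algebra_simps)
  have "smooth_O k 3 (\<lambda>\<epsilon> x. f (x + 1 * \<epsilon>) + f (x + (- 1) * \<epsilon>) - (2 *\<^sub>R f x + \<epsilon>\<^sup>2 *\<^sub>R f2 x))"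
    by (rule smooth_O_cong'[OF smooth_O_add[OF T[of 1] T[of "-1"]]])
      (simp add: vec_eq_iff algebra_simps)
  from smooth_O_scaleR[OF Q this]
  have 2: "smooth_O k 5 (\<lambda>\<epsilon> x. Q \<epsilon> x *\<^sub>R (f (x + 1 * \<epsilon>) + f (x + (- 1) * \<epsilon>) - (2 *\<^sub>R f x + \<epsilon>\<^sup>2 *\<^sub>R f2 x)))"
    by simp
  show ?thesis unfolding Q_def[symmetric]
    by (rule smooth_O_cong'[OF smooth_O_add[OF smooth_O_add[OF 1[of 1] 1[of "- 1"]] 2]])
      (simp_all add: raw_envelope_def vec_eq_iff algebra_simps)
qed

text \<open>After division by 4\<epsilon>^2 the weights carry 1 - \<epsilon>^2 u/3. The factor 1 +
  2/3 \<epsilon>^2 u turns this into 1 + \<epsilon>^2 u/3 + O(\<epsilon>^4), which produces the term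
  u f/3 of \<open>H\<close>.\<close>

lemma envelope_expansion: "smooth_O k 3 (\<lambda>\<epsilon> x. envelope \<epsilon> x - (f x + \<epsilon>\<^sup>2 *\<^sub>R H x))"
proof -
  define Q where "Q \<epsilon> x = 2 * \<epsilon>\<^sup>2 - 2/3 * \<epsilon> ^ 4 * u x" for \<epsilon> x
  define R where "R \<epsilon> x = raw_envelope \<epsilon> x - Q \<epsilon> x *\<^sub>R (2 *\<^sub>R f x + \<epsilon>\<^sup>2 *\<^sub>R f2 x)" for \<epsilon> x
  have "smooth_O k (3 + 2) R" using raw_envelope_expansion[of k] by (simp add: R_def[abs_def] Q_def)
  hence "smooth_O k 3 (\<lambda>\<epsilon> x. (1/4) *\<^sub>R ((1 / \<epsilon>\<^sup>2) *\<^sub>R R \<epsilon> x))"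
    by (intro smooth_O_const_scaleR smooth_O_divide_power)
  moreover have "smooth_O k 0 (\<lambda>\<epsilon> x. 1 + \<epsilon>\<^sup>2 *\<^sub>R (2/3 * u x))"
    by (intro smooth_O_expansion_bounded smooth_on_const smooth_on_mult smooth open_UNIV)
  ultimately have "smooth_O k (0 + 3) (\<lambda>\<epsilon> x. (1 + \<epsilon>\<^sup>2 *\<^sub>R (2/3 * u x)) *\<^sub>R (1/4) *\<^sub>R ((1 / \<epsilon>\<^sup>2) *\<^sub>R R \<epsilon> x))"
    by (rule smooth_O_scaleR[rotated])
  hence 1: "smooth_O k 3 (\<lambda>\<epsilon> x. (1 + \<epsilon>\<^sup>2 *\<^sub>R (2/3 * u x)) *\<^sub>R (1/4) *\<^sub>R ((1 / \<epsilon>\<^sup>2) *\<^sub>R R \<epsilon> x))"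
    by simp
  \<comment> \<open>These are the exact terms of degree 4 and 6 in (1 + 2/3 \<epsilon>^2 u) (1 -
    \<epsilon>^2 u/3) (f + \<epsilon>^2 f''/2).\<close>
  have "smooth_O k (0 + 4) (\<lambda>\<epsilon> x. \<epsilon> ^ 4 *\<^sub>R frame (\<lambda>x. - 2/9 * u x ^ 2) (\<lambda>x. 0) (\<lambda>x. u x / 6) x)"
    "smooth_O k (0 + 6) (\<lambda>\<epsilon> x. \<epsilon> ^ 6 *\<^sub>R frame (\<lambda>x. 0) (\<lambda>x. 0) (\<lambda>x. - (u x)\<^sup>2 / 9) x)"
    by (intro smooth_O_power_scaleR smooth_O_const smooth_on_frame smooth_on_mult smooth_on_power
        smooth_on_divide_const smooth_on_minus smooth_on_const smooth open_UNIV)+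
  hence "smooth_O k 3 (\<lambda>\<epsilon> x. \<epsilon> ^ 4 *\<^sub>R frame (\<lambda>x. - 2/9 * u x ^ 2) (\<lambda>x. 0) (\<lambda>x. u x / 6) x
      + \<epsilon> ^ 6 *\<^sub>R frame (\<lambda>x. 0) (\<lambda>x. 0) (\<lambda>x. - (u x)\<^sup>2 / 9) x)"
    by (intro smooth_O_add) (auto intro: smooth_O_mono)
  from smooth_O_add[OF 1 this] show ?thesis
  proof (rule smooth_O_cong')
    fix \<epsilon> x :: real assume "\<epsilon> > 0"
    hence "envelope \<epsilon> x = (1 + \<epsilon>\<^sup>2 *\<^sub>R (2/3 * u x)) *\<^sub>R (1/4) *\<^sub>R ((1 / \<epsilon>\<^sup>2) *\<^sub>R R \<epsilon> x)
        + (1 + 2/3 * \<epsilon>\<^sup>2 * u x) *\<^sub>R ((1/2 - \<epsilon>\<^sup>2 * u x / 6) *\<^sub>R (2 *\<^sub>R f x + \<epsilon>\<^sup>2 *\<^sub>R f2 x))"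
      by (simp add: envelope_def R_def Q_def vec_eq_iff field_simps power2_eq_square power4_eq_xxxx)
    moreover have "(1 + 2/3 * \<epsilon>\<^sup>2 * u x) *\<^sub>R ((1/2 - \<epsilon>\<^sup>2 * u x / 6) *\<^sub>R (2 *\<^sub>R f x + \<epsilon>\<^sup>2 *\<^sub>R f2 x)) =
      \<epsilon> ^ 4 *\<^sub>R frame (\<lambda>x. - 2/9 * u x ^ 2) (\<lambda>x. 0) (\<lambda>x. u x / 6) x
      + \<epsilon> ^ 6 *\<^sub>R frame (\<lambda>x. 0) (\<lambda>x. 0) (\<lambda>x. - (u x)\<^sup>2 / 9) x + (f x + \<epsilon>\<^sup>2 *\<^sub>R H x)"
      by (simp add: frame_def H_def vec_eq_iff field_simps eval_nat_numeral)
    moreover have "a + b = e - c" if "e = a + d" "d = b + c" for a b c d e :: "real^3"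
      using that by simp
    ultimately show "(1 + \<epsilon>\<^sup>2 *\<^sub>R (2/3 * u x)) *\<^sub>R (1/4) *\<^sub>R ((1 / \<epsilon>\<^sup>2) *\<^sub>R R \<epsilon> x) +
        (\<epsilon> ^ 4 *\<^sub>R frame (\<lambda>x. - 2/9 * u x ^ 2) (\<lambda>x. 0) (\<lambda>x. u x / 6) x
        + \<epsilon> ^ 6 *\<^sub>R frame (\<lambda>x. 0) (\<lambda>x. 0) (\<lambda>x. - (u x)\<^sup>2 / 9) x) =
        envelope \<epsilon> x - (f x + \<epsilon>\<^sup>2 *\<^sub>R H x)"
      by blast
  qed
qed

lemma envelope_wronskian: "smooth_O k 3 (\<lambda>\<epsilon> x. wronskian (envelope \<epsilon>) x - 1)"
proof -
  note 0 = envelope_expansion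
  note 1 = smooth_O_vderiv_expansion[OF smooth(1) smooth_H(1) 0, unfolded vderiv_H]
  note 2 = smooth_O_vderiv_expansion[OF smooth'(1) smooth_H(2) 1, unfolded vderiv_H]
  have "smooth_O k 3 (\<lambda>\<epsilon> x. triple (envelope \<epsilon> x) (vderiv (envelope \<epsilon>) x) (vderiv (vderiv (envelope \<epsilon>)) x)
      - triple (f x + \<epsilon>\<^sup>2 *\<^sub>R H x) (f1 x + \<epsilon>\<^sup>2 *\<^sub>R H1 x) (f2 x + \<epsilon>\<^sup>2 *\<^sub>R H2 x))"
    by (intro smooth_O_triple_diff 0 1 2 smooth_O_expansion_bounded smooth smooth' smooth_H)
  moreover
  have "smooth_O k (0 + 4) (\<lambda>\<epsilon> x. \<epsilon> ^ 4 *\<^sub>R (triple (H x) (H1 x) (f2 x) + triple (H x) (f1 x) (H2 x)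
      + triple (f x) (H1 x) (H2 x)))"
    "smooth_O k (0 + 6) (\<lambda>\<epsilon> x. \<epsilon> ^ 6 *\<^sub>R triple (H x) (H1 x) (H2 x))"
    by (intro smooth_O_power_scaleR smooth_O_const smooth_on_add smooth_on_triple open_UNIV
        smooth smooth' smooth_H)+
  hence "smooth_O k 3 (\<lambda>\<epsilon> x. \<epsilon> ^ 4 *\<^sub>R (triple (H x) (H1 x) (f2 x) + triple (H x) (f1 x) (H2 x)
      + triple (f x) (H1 x) (H2 x)) + \<epsilon> ^ 6 *\<^sub>R triple (H x) (H1 x) (H2 x))"
    by (intro smooth_O_add) (auto intro: smooth_O_mono)
  ultimately show ?thesis
  proof (rule smooth_O_cong'[OF smooth_O_add])
    fix \<epsilon> x :: real
    \<comment> \<open>The three contributions are u/3, -u/6 and -u/6.\<close>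
    have "triple (H x) (f1 x) (f2 x) + triple (f x) (H1 x) (f2 x) + triple (f x) (f1 x) (H2 x) = 0"
      by (simp add: H_def H1_def H2_def frame_def triple_f)
    moreover have "triple (f x + \<epsilon>\<^sup>2 *\<^sub>R H x) (f1 x + \<epsilon>\<^sup>2 *\<^sub>R H1 x) (f2 x + \<epsilon>\<^sup>2 *\<^sub>R H2 x) =
        1 + \<epsilon>\<^sup>2 * (triple (H x) (f1 x) (f2 x) + triple (f x) (H1 x) (f2 x) + triple (f x) (f1 x) (H2 x))
        + \<epsilon> ^ 4 * (triple (H x) (H1 x) (f2 x) + triple (H x) (f1 x) (H2 x) + triple (f x) (H1 x) (H2 x))
        + \<epsilon> ^ 6 * triple (H x) (H1 x) (H2 x)"
      by (simp add: triple_f algebra_simps eval_nat_numeral)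
    ultimately show "triple (envelope \<epsilon> x) (vderiv (envelope \<epsilon>) x) (vderiv (vderiv (envelope \<epsilon>)) x)
      - triple (f x + \<epsilon>\<^sup>2 *\<^sub>R H x) (f1 x + \<epsilon>\<^sup>2 *\<^sub>R H1 x) (f2 x + \<epsilon>\<^sup>2 *\<^sub>R H2 x) +
      (\<epsilon> ^ 4 *\<^sub>R (triple (H x) (H1 x) (f2 x) + triple (H x) (f1 x) (H2 x) + triple (f x) (H1 x) (H2 x))
       + \<epsilon> ^ 6 *\<^sub>R triple (H x) (H1 x) (H2 x)) = wronskian (envelope \<epsilon>) x - 1"
      by (simp add: wronskian_def)
  qed
qed

section \<open>Monodromy of the lifted envelope\<close>

lemma det_monodromy: "det A = 1"
proof -
  have "wronskian (\<lambda>x. f (x + 1)) 0 = wronskian (\<lambda>x. A *v f x) 0" by (simp add: monodromy)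
  thus ?thesis by (simp add: wronskian_shift wronskian_matrix_vector W)
qed

lemma coeff_periodic: "coeff s \<epsilon> (x + 1) = coeff s \<epsilon> x"
proof -
  have m: "f (x + 1 + c) = A *v f (x + c)" for x c
    using monodromy[of "x + c"] by (simp add: algebra_simps)
  have "f1 (x + 1) = A *v f1 x" for x
    using vderiv_shift[of f 1 x] vderiv_matrix_vector[of f x A] by (simp add: monodromy)
  hence m1: "f1 (x + 1 + c) = A *v f1 (x + c)" for x c
    by (metis add.assoc add.commute)
  show ?thesis unfolding coeff_def m m1 triple_matrix det_monodromy by simp
qed

lemma envelope_monodromy: "envelope \<epsilon> (x + 1) = A *v envelope \<epsilon> x"
proof -
  have m: "f (x + 1 + c) = A *v f (x + c)" for x c
    using monodromy[of "x + c"] by (simp add: algebra_simps)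
  show ?thesis unfolding envelope_def raw_envelope_def coeff_periodic m periodic
    by (simp add: matrix_vector_right_distrib matrix_vector_mult_scaleR)
qed

lemma envelope_wronskian_periodic: "wronskian (envelope \<epsilon>) (x + 1) = wronskian (envelope \<epsilon>) x"
proof -
  have "wronskian (\<lambda>x. envelope \<epsilon> (x + 1)) x = wronskian (\<lambda>x. A *v envelope \<epsilon> x) x"
    by (simp add: envelope_monodromy)
  thus ?thesis
    by (simp add: wronskian_shift wronskian_matrix_vector smooth_on_envelope det_monodromy)
qed

end

lemma periodic_eq_frac:
  fixes g :: "real \<Rightarrow> 'a"
  assumes "\<And>x. g (x + 1) = g x"
  shows "g x = g (frac x)"
proof -
  interpret periodic_fun_simple' g by unfold_locales (rule assms)
  show ?thesis using minus_of_int[of x "\<lfloor>x\<rfloor>"] by (simp add: frac_def)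
qed

lemma frac_in_unit: "frac x \<in> {0..1 :: real}"
  using frac_ge_0[of x] frac_lt_1[of x] by simp

context lifted_curve
begin

text \<open>The expansion gives positivity on the unit interval, and periodicity extends it to all
  \<open>x\<close> for the same \<epsilon>. The inverse cube root needs it on the whole
  line.\<close>

lemma envelope_wronskian_pos: "\<forall>\<^sub>F \<epsilon> in at_right 0. \<forall>x. wronskian (envelope \<epsilon>) x > 0"
proof -
  obtain C where C: "C \<ge> 0"
    "\<forall>\<^sub>F \<epsilon> in at_right 0. \<forall>x\<in>{0..1}. norm (wronskian (envelope \<epsilon>) x - 1) \<le> C * \<epsilon> ^ 3"
    using smooth_O_bounded[OF envelope_wronskian[of 0], of 0] by (auto elim: bounded_OE)
  have c: "1 / (C + 1) > 0" using C by simp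
  show ?thesis using C(2) eventually_small[OF zero_less_one] eventually_small[OF c]
  proof eventually_elim
    case (elim \<epsilon>)
    have "\<epsilon> ^ 3 \<le> \<epsilon> ^ 1" using elim by (intro power_decreasing) auto
    hence "C * \<epsilon> ^ 3 \<le> (C + 1) * \<epsilon>" using C elim by (intro mult_mono) auto
    also have "\<dots> < 1" using elim C(1) by (simp add: field_simps)
    finally have "norm (wronskian (envelope \<epsilon>) (frac x) - 1) < 1" for x
      using elim(1) frac_in_unit[of x] by (meson le_less_trans)
    hence "wronskian (envelope \<epsilon>) (frac x) > 0" for x
      by (smt (verit) real_norm_def)
    thus ?case using periodic_eq_frac[of "wronskian (envelope \<epsilon>)"] envelope_wronskian_periodic by metis
  qed
qed

text \<open>With weights p and q, the derivative of the raw lift can leave the plane of the chord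
  only through p f'(x + \<epsilon>) + q f'(x - \<epsilon>). Pairing this with the end points gives p
  q - q p = 0, which is where the weights come from.\<close>

lemma chord_eq_tangent:
  assumes "wronskian (envelope \<epsilon>) x \<noteq> 0"
  shows "span {f (x - \<epsilon>), f (x + \<epsilon>)} = span {envelope \<epsilon> x, vderiv (envelope \<epsilon>) x}"
proof -
  let ?p = "f (x - \<epsilon>)" and ?q = "f (x + \<epsilon>)" and ?r = "\<lambda>x. (1 + 2/3 * \<epsilon>\<^sup>2 * u x) / (4 * \<epsilon>\<^sup>2)"
  let ?V = "span {?p, ?q}"
  have sw: "triple ?p ?q (f1 (x - \<epsilon>)) = - coeff 1 \<epsilon> x" "triple ?p ?q (f1 (x + \<epsilon>)) = coeff (- 1) \<epsilon> x"
    by (simp_all add: coeff_def triple_cross cross3_simps)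
  have E: "raw_envelope \<epsilon> x \<in> ?V"
    unfolding raw_envelope_def by (intro span_add span_scale span_base) auto
  let ?z = "coeff 1 \<epsilon> x *\<^sub>R f1 (x + \<epsilon>) + coeff (- 1) \<epsilon> x *\<^sub>R f1 (x - \<epsilon>)"
  \<comment> \<open>A nonzero weight witnesses that the end points are independent; otherwise the
    lift of the envelope would vanish, contrary to its nonzero Wronskian.\<close>
  have nz: "coeff 1 \<epsilon> x \<noteq> 0 \<or> coeff (- 1) \<epsilon> x \<noteq> 0"
  proof (rule ccontr)
    assume "\<not> ?thesis"
    hence "envelope \<epsilon> x = 0" by (simp add: envelope_def raw_envelope_def)
    thus False using wronskian_nonzero[OF assms] by simp
  qed
  have "triple ?p ?q ?z = 0" by (simp add: sw)
  hence z: "?z \<in> ?V"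
    using nz span_pair_triple_conv[of ?p ?q "f1 (x - \<epsilon>)" ?z] span_pair_triple_conv[of ?p ?q "f1 (x + \<epsilon>)" ?z]
    by (auto simp: sw)
  have d: "(\<lambda>x. f (x + c)) differentiable (at x)" "coeff s \<epsilon> differentiable (at x)" for c s
    by (intro smooth_on_differentiable[OF smooth_on_shift[OF smooth(1)]]
        smooth_on_differentiable[OF smooth_on_coeff] UNIV_I)+
  have "vderiv (raw_envelope \<epsilon>) x = (coeff 1 \<epsilon> x *\<^sub>R f1 (x + 1 * \<epsilon>) + vderiv (coeff 1 \<epsilon>) x *\<^sub>R f (x + 1 * \<epsilon>))
      + (coeff (- 1) \<epsilon> x *\<^sub>R f1 (x + (- 1) * \<epsilon>) + vderiv (coeff (- 1) \<epsilon>) x *\<^sub>R f (x + (- 1) * \<epsilon>))"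
    unfolding raw_envelope_def[abs_def]
    by (subst vderiv_add; (intro differentiable_scaleR d)?; subst vderiv_scaleR; (intro d)?;
        subst vderiv_scaleR; (intro d)?; simp only: vderiv_shift)
  also have "\<dots> = ?z + (vderiv (coeff 1 \<epsilon>) x *\<^sub>R ?q + vderiv (coeff (- 1) \<epsilon>) x *\<^sub>R ?p)"
    by simp
  also have "\<dots> \<in> ?V" by (intro span_add z span_scale span_base) auto
  finally have E': "vderiv (raw_envelope \<epsilon>) x \<in> ?V" .
  have "vderiv (envelope \<epsilon>) x = ?r x *\<^sub>R vderiv (raw_envelope \<epsilon>) x + vderiv ?r x *\<^sub>R raw_envelope \<epsilon> x"
    unfolding envelope_def[abs_def]
    by (intro vderiv_scaleR smooth_on_differentiable[OF smooth_on_factor]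
        smooth_on_differentiable[OF smooth_on_raw_envelope] UNIV_I)
  also have "\<dots> \<in> ?V" by (intro span_add span_scale E E')
  finally have "vderiv (envelope \<epsilon>) x \<in> ?V" .
  moreover have "envelope \<epsilon> x \<in> ?V" unfolding envelope_def by (intro span_scale E)
  ultimately show ?thesis using assms unfolding wronskian_def by (intro span_pair_eq)
qed

definition unimodular_envelope :: "real \<Rightarrow> real \<Rightarrow> real^3" where
  "unimodular_envelope \<epsilon> x = wronskian (envelope \<epsilon>) x powr (- 1/3) *\<^sub>R envelope \<epsilon> x"

abbreviation "g \<equiv> unimodular_envelope"

text \<open>This is w' for w = v - u'/2.\<close>

definition u_tilde where "u_tilde x = v1 x - u2 x / 2"
definition v_tilde where "v_tilde x = v2 x / 2 - (u3 x + u x * u1 x) / 3"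
definition u_env where "u_env \<epsilon> x = - triple (g \<epsilon> x) ((vderiv ^^ 3) (g \<epsilon>) x) (vderiv (vderiv (g \<epsilon>)) x)"
definition v_env where
  "v_env \<epsilon> x = - triple ((vderiv ^^ 3) (g \<epsilon>) x) (vderiv (g \<epsilon>) x) (vderiv (vderiv (g \<epsilon>)) x)"

lemma smooth_tilde [simp]: "smooth_on UNIV u_tilde" "smooth_on UNIV v_tilde"
  unfolding u_tilde_def[abs_def] v_tilde_def[abs_def]
  by (intro smooth_on_diff smooth_on_divide_const smooth_on_add smooth_on_mult open_UNIV smooth smooth'
      smooth_on_vderiv)+

lemma unimodular_envelope_lift:
  assumes "\<forall>x. wronskian (envelope \<epsilon>) x > 0"
  shows "smooth_on UNIV (g \<epsilon>)" "wronskian (g \<epsilon>) x = 1" "g \<epsilon> (x + 1) = A *v g \<epsilon> x"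
proof -
  have r: "smooth_on UNIV (\<lambda>x. wronskian (envelope \<epsilon>) x powr (- 1/3))"
    using assms by (intro smooth_on_inverse_cbrt smooth_on_wronskian smooth_on_envelope open_UNIV) auto
  show "smooth_on UNIV (g \<epsilon>)" unfolding unimodular_envelope_def[abs_def]
    by (intro smooth_on_scaleR r smooth_on_envelope open_UNIV)
  show "wronskian (g \<epsilon>) x = 1" unfolding unimodular_envelope_def[abs_def]
      wronskian_scaleR[OF open_UNIV UNIV_I r smooth_on_envelope]
    using assms by (intro inverse_cbrt_cube) simp
  show "g \<epsilon> (x + 1) = A *v g \<epsilon> x"
    by (simp add: unimodular_envelope_def envelope_wronskian_periodic envelope_monodromy
        matrix_vector_mult_scaleR)
qed

text \<open>The final rescaling differs from 1 by O(\<epsilon>^3) and multiplies a bounded lift, so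
  the expansion is preserved.\<close>

lemma unimodular_envelope_expansion: "smooth_O k 3 (\<lambda>\<epsilon> x. g \<epsilon> x - (f x + \<epsilon>\<^sup>2 *\<^sub>R H x))"
proof -
  have b: "smooth_O k 0 (\<lambda>\<epsilon> x. (envelope \<epsilon> x - (f x + \<epsilon>\<^sup>2 *\<^sub>R H x)) + (f x + \<epsilon>\<^sup>2 *\<^sub>R H x))"
    by (intro smooth_O_add smooth_O_expansion_bounded smooth smooth_H
        smooth_O_mono[OF envelope_expansion]) simp
  hence b: "smooth_O k 0 envelope" by simp
  have "smooth_O k 3 (\<lambda>\<epsilon> x. wronskian (envelope \<epsilon>) x powr (- 1/3) - 1)"
    by (intro smooth_O_inverse_cbrt envelope_wronskian envelope_wronskian_pos) simp
  from smooth_O_scaleR[OF this b]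
  have "smooth_O k 3 (\<lambda>\<epsilon> x. (wronskian (envelope \<epsilon>) x powr (- 1/3) - 1) *\<^sub>R envelope \<epsilon> x)" by simp
  from smooth_O_add[OF this envelope_expansion] show ?thesis
    by (rule smooth_O_cong') (simp add: unimodular_envelope_def algebra_simps)
qed

text \<open>The equation linearized at order \<epsilon>^2. The components along f'' cancel, as do
  the products u v along f; the rest along f' and f dictates \<open>u_tilde\<close> and
  \<open>v_tilde\<close>.\<close>

lemma expansion_ode:
  "H3 x + u x *\<^sub>R H1 x + v x *\<^sub>R H x + u_tilde x *\<^sub>R f1 x + v_tilde x *\<^sub>R f x = 0"
  by (simp add: H3_def H1_def H_def u_tilde_def v_tilde_def frame_def vec_eq_iff field_simps power2_eq_square)

text \<open>The residue \<open>S\<close> of the equation with the predicted coefficients is of order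
  3, because its part of order \<epsilon>^2 vanishes by \<open>expansion_ode\<close>. Pairing
  \<open>S\<close> with two of g, g', g'' isolates the error of one coefficient.\<close>

lemma
  shows u_env_expansion: "smooth_O k 3 (\<lambda>\<epsilon> x. u_env \<epsilon> x - (u x + \<epsilon>\<^sup>2 *\<^sub>R u_tilde x))"
    and v_env_expansion: "smooth_O k 3 (\<lambda>\<epsilon> x. v_env \<epsilon> x - (v x + \<epsilon>\<^sup>2 *\<^sub>R v_tilde x))"
proof -
  note 0 = unimodular_envelope_expansion
  note 1 = smooth_O_vderiv_expansion[OF smooth(1) smooth_H(1) 0, unfolded vderiv_H]
  note 2 = smooth_O_vderiv_expansion[OF smooth'(1) smooth_H(2) 1, unfolded vderiv_H]
  note 3 = smooth_O_vderiv_expansion[OF smooth'(2) smooth_H(3) 2, unfolded vderiv_H]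
  have bounded: "smooth_O k 0 F"
    if "smooth_O k 3 (\<lambda>\<epsilon> x. F \<epsilon> x - (p x + \<epsilon>\<^sup>2 *\<^sub>R q x))" "smooth_on UNIV p" "smooth_on UNIV q"
    for F :: "real \<Rightarrow> real \<Rightarrow> real^3" and p q
    using smooth_O_add[OF smooth_O_mono[OF that(1)] smooth_O_expansion_bounded[OF that(2,3)]] by simp
  have b0: "smooth_O k 0 g" and b1: "smooth_O k 0 (\<lambda>\<epsilon>. vderiv (g \<epsilon>))"
    and b2: "smooth_O k 0 (\<lambda>\<epsilon>. vderiv (vderiv (g \<epsilon>)))"
    by (rule bounded[OF 0] bounded[OF 1] bounded[OF 2]; simp)+
  define S where "S \<epsilon> x = vderiv (vderiv (vderiv (g \<epsilon>))) x + (u x + \<epsilon>\<^sup>2 *\<^sub>R u_tilde x) *\<^sub>R vderiv (g \<epsilon>) x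
      + (v x + \<epsilon>\<^sup>2 *\<^sub>R v_tilde x) *\<^sub>R g \<epsilon> x" for \<epsilon> x
  have "smooth_O k 3 (\<lambda>\<epsilon> x. (u x + \<epsilon>\<^sup>2 *\<^sub>R u_tilde x) *\<^sub>R (vderiv (g \<epsilon>) x - (f1 x + \<epsilon>\<^sup>2 *\<^sub>R H1 x)))"
    "smooth_O k 3 (\<lambda>\<epsilon> x. (v x + \<epsilon>\<^sup>2 *\<^sub>R v_tilde x) *\<^sub>R (g \<epsilon> x - (f x + \<epsilon>\<^sup>2 *\<^sub>R H x)))"
    using smooth_O_scaleR[OF smooth_O_expansion_bounded[OF smooth(2) smooth_tilde(1)] 1]
      smooth_O_scaleR[OF smooth_O_expansion_bounded[OF smooth(3) smooth_tilde(2)] 0] by simp_all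
  note * = smooth_O_add[OF 3 smooth_O_add[OF this]]
  have "smooth_O k (0 + 4) (\<lambda>\<epsilon> x. \<epsilon> ^ 4 *\<^sub>R (u_tilde x *\<^sub>R H1 x + v_tilde x *\<^sub>R H x))"
    by (intro smooth_O_power_scaleR smooth_O_const smooth_on_add smooth_on_scaleR open_UNIV smooth_H smooth_tilde)
  hence "smooth_O k 3 (\<lambda>\<epsilon> x. \<epsilon> ^ 4 *\<^sub>R (u_tilde x *\<^sub>R H1 x + v_tilde x *\<^sub>R H x))"
    by (rule smooth_O_mono) simp
  from smooth_O_add[OF * this] have S: "smooth_O k 3 S"
  proof (rule smooth_O_cong')
    fix \<epsilon> x :: real
    have "(vderiv f2 x + \<epsilon>\<^sup>2 *\<^sub>R H3 x) + (u x + \<epsilon>\<^sup>2 *\<^sub>R u_tilde x) *\<^sub>R (f1 x + \<epsilon>\<^sup>2 *\<^sub>R H1 x)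
        + (v x + \<epsilon>\<^sup>2 *\<^sub>R v_tilde x) *\<^sub>R (f x + \<epsilon>\<^sup>2 *\<^sub>R H x) =
      \<epsilon>\<^sup>2 *\<^sub>R (H3 x + u x *\<^sub>R H1 x + v x *\<^sub>R H x + u_tilde x *\<^sub>R f1 x + v_tilde x *\<^sub>R f x)
        + \<epsilon> ^ 4 *\<^sub>R (u_tilde x *\<^sub>R H1 x + v_tilde x *\<^sub>R H x)"
      by (simp add: vderiv_f2 vec_eq_iff algebra_simps eval_nat_numeral)
    also have "\<dots> = \<epsilon> ^ 4 *\<^sub>R (u_tilde x *\<^sub>R H1 x + v_tilde x *\<^sub>R H x)" by (simp add: expansion_ode)
    finally show "vderiv (vderiv (vderiv (g \<epsilon>))) x - (vderiv f2 x + \<epsilon>\<^sup>2 *\<^sub>R H3 x) +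
        ((u x + \<epsilon>\<^sup>2 *\<^sub>R u_tilde x) *\<^sub>R (vderiv (g \<epsilon>) x - (f1 x + \<epsilon>\<^sup>2 *\<^sub>R H1 x)) +
         (v x + \<epsilon>\<^sup>2 *\<^sub>R v_tilde x) *\<^sub>R (g \<epsilon> x - (f x + \<epsilon>\<^sup>2 *\<^sub>R H x))) +
        \<epsilon> ^ 4 *\<^sub>R (u_tilde x *\<^sub>R H1 x + v_tilde x *\<^sub>R H x) = S \<epsilon> x"
      unfolding S_def by (simp only: scaleR_right_diff_distrib) (simp add: algebra_simps)
  qed
  \<comment> \<open>Since the Wronskian is exactly 1, the pairings with \<open>S\<close> are, up to
    sign, exactly the errors of the coefficients.\<close>
  have W1: "\<forall>\<^sub>F \<epsilon> in at_right 0. \<forall>x. wronskian (g \<epsilon>) x = 1"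
    using envelope_wronskian_pos by eventually_elim (use unimodular_envelope_lift(2) in blast)
  have "smooth_O k (0 + (3 + 0)) (\<lambda>\<epsilon> x. triple (g \<epsilon> x) (S \<epsilon> x) (vderiv (vderiv (g \<epsilon>)) x))"
    by (intro smooth_O_triple b0 b2 S)
  hence "smooth_O k 3 (\<lambda>\<epsilon> x. - triple (g \<epsilon> x) (S \<epsilon> x) (vderiv (vderiv (g \<epsilon>)) x))"
    by (intro smooth_O_minus) simp
  thus "smooth_O k 3 (\<lambda>\<epsilon> x. u_env \<epsilon> x - (u x + \<epsilon>\<^sup>2 *\<^sub>R u_tilde x))"
  proof (rule smooth_O_cong)
    show "\<forall>\<^sub>F \<epsilon> in at_right 0. (\<lambda>x. - triple (g \<epsilon> x) (S \<epsilon> x) (vderiv (vderiv (g \<epsilon>)) x)) =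
        (\<lambda>x. u_env \<epsilon> x - (u x + \<epsilon>\<^sup>2 *\<^sub>R u_tilde x))"
      using W1 by eventually_elim (auto simp: fun_eq_iff S_def u_env_def vderiv_3 wronskian_def)
  qed
  have "smooth_O k (3 + (0 + 0)) (\<lambda>\<epsilon> x. triple (S \<epsilon> x) (vderiv (g \<epsilon>) x) (vderiv (vderiv (g \<epsilon>)) x))"
    by (intro smooth_O_triple b1 b2 S)
  hence "smooth_O k 3 (\<lambda>\<epsilon> x. - triple (S \<epsilon> x) (vderiv (g \<epsilon>) x) (vderiv (vderiv (g \<epsilon>)) x))"
    by (intro smooth_O_minus) simp
  thus "smooth_O k 3 (\<lambda>\<epsilon> x. v_env \<epsilon> x - (v x + \<epsilon>\<^sup>2 *\<^sub>R v_tilde x))"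
  proof (rule smooth_O_cong)
    show "\<forall>\<^sub>F \<epsilon> in at_right 0. (\<lambda>x. - triple (S \<epsilon> x) (vderiv (g \<epsilon>) x) (vderiv (vderiv (g \<epsilon>)) x)) =
        (\<lambda>x. v_env \<epsilon> x - (v x + \<epsilon>\<^sup>2 *\<^sub>R v_tilde x))"
      using W1 by eventually_elim (auto simp: fun_eq_iff S_def v_env_def vderiv_3 wronskian_def)
  qed
qed

end

section \<open>The continuous limit\<close>

lemma line_through_lifts:
  assumes "a \<in> Rep_rp2 p" "a \<noteq> 0" "b \<in> Rep_rp2 q" "b \<noteq> 0"
  shows "line_through p q = span {a, b}"
proof -
  have "span (span {a} \<union> span {b}) = span {a, b}"
  proof (rule antisym)
    show "span (span {a} \<union> span {b}) \<subseteq> span {a, b}"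
      by (intro span_minimal subspace_span Un_least span_mono) auto
    show "span {a, b} \<subseteq> span (span {a} \<union> span {b})"
      by (rule span_mono) (auto intro: span_base)
  qed
  thus ?thesis by (simp add: line_through_def Rep_rp2_eq_span[OF assms(1,2)] Rep_rp2_eq_span[OF assms(3,4)])
qed

section \<open>Uniform expansions of periodic functions and their uniqueness\<close>

lemma vderiv_periodic:
  assumes "\<And>x. h (x + 1) = h x"
  shows "vderiv h (x + 1) = vderiv h x"
  using vderiv_shift[of h 1 x] by (simp add: assms)

lemma deriv_funpow_eq_vderiv: "(deriv ^^ n) h = (vderiv ^^ n) (h :: real \<Rightarrow> real)"
  by (induction n) (simp_all add: deriv_eq_vderiv)

lemma corresponds_periodic:
  assumes "corresponds \<gamma> u w"
  shows "u (x + 1) = u x" "w (x + 1) = w x"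
  using assms vderiv_periodic[of u]
  by (auto simp: corresponds_def smooth_periodic_def deriv_eq_vderiv)

text \<open>Periodicity of all three functions spreads the bound from the unit interval to the line.
  \<open>G\<close> stands for a description that agrees with the explicit \<open>F\<close> only for
  small \<epsilon>.\<close>

lemma expands2I:
  assumes "smooth_O 0 3 (\<lambda>\<epsilon> x. F \<epsilon> x - (p x + \<epsilon>\<^sup>2 *\<^sub>R q x))"
    and "\<forall>\<^sub>F \<epsilon> in at_right 0. G \<epsilon> = F \<epsilon> \<and> (\<forall>x. F \<epsilon> (x + 1) = F \<epsilon> x)"
    and "\<And>x. p (x + 1) = p x" "\<And>x. q (x + 1) = q x"
  shows "expands2 G p q"
proof -
  obtain C where C: "\<forall>\<^sub>F \<epsilon> in at_right 0. \<forall>x\<in>{0..1}. norm (F \<epsilon> x - (p x + \<epsilon>\<^sup>2 *\<^sub>R q x)) \<le> C * \<epsilon> ^ 3"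
    using assms(1) by (auto simp: smooth_O_0 bounded_O_def)
  have "\<forall>\<^sub>F \<epsilon> in at_right 0. \<forall>x. \<bar>G \<epsilon> x - (p x + \<epsilon>\<^sup>2 * q x)\<bar> \<le> C * \<epsilon> ^ 3"
    using C assms(2)
  proof eventually_elim
    case (elim \<epsilon>)
    show ?case
    proof
      fix x
      have "F \<epsilon> x - (p x + \<epsilon>\<^sup>2 *\<^sub>R q x) = F \<epsilon> (frac x) - (p (frac x) + \<epsilon>\<^sup>2 *\<^sub>R q (frac x))"
        by (rule periodic_eq_frac) (simp add: elim assms(3,4))
      thus "\<bar>G \<epsilon> x - (p x + \<epsilon>\<^sup>2 * q x)\<bar> \<le> C * \<epsilon> ^ 3"
        using elim frac_in_unit[of x] by simp
    qed
  qed
  thus ?thesis unfolding expands2_def by blast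
qed

text \<open>Makes the coefficients of \<epsilon>^2 definite, so that the quantified
  \<open>ut\<close> and \<open>wt\<close> in \<open>continuous_limit_equation\<close> can be
  eliminated.\<close>

lemma expands2_unique:
  assumes "expands2 F p q" "expands2 F p r"
  shows "q = r"
proof
  fix x
  obtain C D where C: "\<forall>\<^sub>F \<epsilon> in at_right 0. \<forall>x. \<bar>F \<epsilon> x - (p x + \<epsilon>\<^sup>2 * q x)\<bar> \<le> C * \<epsilon> ^ 3"
    and D: "\<forall>\<^sub>F \<epsilon> in at_right 0. \<forall>x. \<bar>F \<epsilon> x - (p x + \<epsilon>\<^sup>2 * r x)\<bar> \<le> D * \<epsilon> ^ 3"
    using assms unfolding expands2_def by blast
  show "q x = r x"
  proof (rule ccontr)
    assume "q x \<noteq> r x"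
    \<comment> \<open>Below this threshold the combined remainder is smaller than the difference of
      the two terms of order 2; adding 1 keeps the denominator positive.\<close>
    hence "\<bar>q x - r x\<bar> / (\<bar>C + D\<bar> + 1) > 0" by simp
    from eventually_conj[OF C eventually_conj[OF D eventually_small[OF this]]]
    obtain \<epsilon> where \<epsilon>: "\<bar>F \<epsilon> x - (p x + \<epsilon>\<^sup>2 * q x)\<bar> \<le> C * \<epsilon> ^ 3" "\<bar>F \<epsilon> x - (p x + \<epsilon>\<^sup>2 * r x)\<bar> \<le> D * \<epsilon> ^ 3"
      "0 < \<epsilon>" "\<epsilon> < \<bar>q x - r x\<bar> / (\<bar>C + D\<bar> + 1)"
      using eventually_happens'[OF trivial_limit_at_right_real] by blast
    have "\<epsilon>\<^sup>2 * \<bar>q x - r x\<bar> = \<bar>(F \<epsilon> x - (p x + \<epsilon>\<^sup>2 * r x)) - (F \<epsilon> x - (p x + \<epsilon>\<^sup>2 * q x))\<bar>"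
      using abs_mult[of "\<epsilon>\<^sup>2" "q x - r x"] by (simp add: algebra_simps)
    also have "\<dots> \<le> C * \<epsilon> ^ 3 + D * \<epsilon> ^ 3" using \<epsilon>(1,2) by linarith
    also have "\<dots> = \<epsilon>\<^sup>2 * ((C + D) * \<epsilon>)" by (simp add: power2_eq_square power3_eq_cube algebra_simps)
    finally have "\<bar>q x - r x\<bar> \<le> (C + D) * \<epsilon>" using \<epsilon>(3) by simp
    also have "\<dots> \<le> (\<bar>C + D\<bar> + 1) * \<epsilon>" using \<epsilon>(3) by (intro mult_right_mono) auto
    also have "\<dots> < \<bar>q x - r x\<bar>" using \<epsilon>(4) by (simp add: pos_less_divide_eq mult.commute)
    finally show False by simp
  qed
qed

context lifted_curve
begin

definition w_env where "w_env \<epsilon> x = v_env \<epsilon> x - vderiv (u_env \<epsilon>) x / 2"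

text \<open>The equivalence gives existence and uniqueness at once and evaluates the description in
  \<open>chord_envelope\<close>. The scalar \<open>c\<close> disappears in the projective plane, so
  the envelope keeps the monodromy \<open>M\<close>.\<close>

lemma envelope_curve:
  assumes \<gamma>: "nondegenerate_curve M \<gamma>" "\<And>x. f x \<in> Rep_rp2 (\<gamma> x)" and A: "A = c *\<^sub>R M" "c \<noteq> 0"
    and pos: "\<forall>x. wronskian (envelope \<epsilon>) x > 0"
  shows "is_envelope (chord \<gamma> \<epsilon>) \<delta> \<longleftrightarrow> \<delta> = (\<lambda>x. pt (envelope \<epsilon> x))"    and "nondegenerate_curve M (\<lambda>x. pt (envelope \<epsilon> x))"
    and "corresponds (\<lambda>x. pt (envelope \<epsilon> x)) (u_env \<epsilon>) (w_env \<epsilon>)"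
proof -
  let ?\<delta> = "\<lambda>x. pt (envelope \<epsilon> x)"
  have nz: "envelope \<epsilon> x \<noteq> 0" "wronskian (envelope \<epsilon>) x \<noteq> 0" for x
    using pos wronskian_nonzero[of "envelope \<epsilon>" x] less_irrefl by (metis, metis)
  have Rep: "Rep_rp2 (?\<delta> x) = span {envelope \<epsilon> x}" for x by (rule Rep_pt[OF nz(1)])
  have lift: "regular_lift ?\<delta> (envelope \<epsilon>)"
    unfolding regular_lift_def Rep by (simp add: smooth_on_envelope nz span_base)
  have "f x \<noteq> 0" for x using wronskian_nonzero[of f x] W by simp
  hence chord: "chord \<gamma> \<epsilon> = (\<lambda>x. span {envelope \<epsilon> x, vderiv (envelope \<epsilon>) x})"
    unfolding chord_def chord_eq_tangent[OF nz(2), symmetric] using \<gamma>(2)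
    by (intro ext line_through_lifts) auto
  show "is_envelope (chord \<gamma> \<epsilon>) \<delta> \<longleftrightarrow> \<delta> = ?\<delta>"
    unfolding chord
  proof
    assume "\<delta> = ?\<delta>"
    thus "is_envelope (\<lambda>x. span {envelope \<epsilon> x, vderiv (envelope \<epsilon>) x}) \<delta>"
      by (simp only: regular_lift_is_envelope[OF lift])
  qed (rule envelope_unique[OF lift])
  have M: "invertible M" using \<gamma>(1) by (simp add: nondegenerate_curve_def)
  show "nondegenerate_curve M ?\<delta>"
    using lift M by (rule regular_lift_nondegenerate) (simp add: envelope_monodromy A proj_map_pt[OF M nz(1) A(2)])
  have "unimodular_lift ?\<delta> (g \<epsilon>)"
    unfolding unimodular_lift_iff Rep using unimodular_envelope_lift[OF pos]
    by (simp add: unimodular_envelope_def span_scale span_base)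
  from corresponds_unimodular_lift[OF this unimodular_envelope_lift(3)[OF pos]]
  show "corresponds ?\<delta> (u_env \<epsilon>) (w_env \<epsilon>)"
    by (simp add: u_env_def[abs_def] v_env_def[abs_def] w_env_def[abs_def])
qed

text \<open>Half the derivative of \<open>u_tilde\<close> is subtracted from \<open>v_tilde\<close>:
  v'' cancels, and -u'''/3 + u'''/4 leaves -u'''/12. The expansion of \<open>u_env\<close> must be
  differentiable for this.\<close>

lemma w_env_expansion:
  "smooth_O k 3 (\<lambda>\<epsilon> x. w_env \<epsilon> x - ((v x - u1 x / 2) + \<epsilon>\<^sup>2 *\<^sub>R (- (u x * u1 x) / 3 - u3 x / 12)))"
proof -
  have "vderiv u_tilde = (\<lambda>x. v2 x - u3 x / 2)"
    by (rule ext) (simp add: u_tilde_def[abs_def] vderivs)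
  hence "smooth_O k 3 (\<lambda>\<epsilon> x. vderiv (u_env \<epsilon>) x - (u1 x + \<epsilon>\<^sup>2 *\<^sub>R (v2 x - u3 x / 2)))"
    using smooth_O_vderiv_expansion[OF smooth(2) smooth_tilde(1) u_env_expansion] by simp
  hence "smooth_O k 3 (\<lambda>\<epsilon> x. (- 1/2) *\<^sub>R (vderiv (u_env \<epsilon>) x - (u1 x + \<epsilon>\<^sup>2 *\<^sub>R (v2 x - u3 x / 2))))"
    by (rule smooth_O_const_scaleR)
  from smooth_O_add[OF v_env_expansion this] show ?thesis
    by (rule smooth_O_cong') (simp add: w_env_def v_tilde_def field_simps)
qed

end

text \<open>The lift is already a witness inside \<open>corresponds\<close>; what is added is its
  linear monodromy, a multiple of \<open>M\<close>.\<close>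

lemma nondegenerate_curve_lifted:
  assumes "nondegenerate_curve M \<gamma>" "corresponds \<gamma> u w"
  obtains f v c where "lifted_curve f u v (c *\<^sub>R M)" "c \<noteq> 0" "\<And>x. f x \<in> Rep_rp2 (\<gamma> x)"
    "w = (\<lambda>x. v x - vderiv u x / 2)"
proof -
  obtain f v where f: "unimodular_lift \<gamma> f" and uv: "smooth_periodic u" "smooth_periodic v"
    and ode: "\<And>x. (vderiv ^^ 3) f x + u x *\<^sub>R vderiv f x + v x *\<^sub>R f x = 0"
    and w: "w = (\<lambda>x. v x - vderiv u x / 2)"
    using assms(2) unfolding corresponds_def deriv_eq_vderiv by blast
  have M: "invertible M" "\<And>x. \<gamma> (x + 1) = proj_map M (\<gamma> x)"
    using assms(1) by (simp_all add: nondegenerate_curve_def)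
  obtain c where c: "c \<noteq> 0" "\<And>x. f (x + 1) = (c *\<^sub>R M) *v f x"
    using unimodular_lift_monodromy[OF M f] by metis
  have "lifted_curve f u v (c *\<^sub>R M)"
    using f uv ode c by unfold_locales (auto simp: unimodular_lift_iff smooth_periodic_def)
  thus ?thesis using c(1) f w that by (simp add: unimodular_lift_iff)
qed

lemma envelope_expansions:
  assumes "nondegenerate_curve M \<gamma>" "corresponds \<gamma> u w"
  shows "\<forall>\<^sub>F \<epsilon> in at_right 0.
         (\<exists>!\<delta>. is_envelope (chord \<gamma> \<epsilon>) \<delta>) \<and>
         nondegenerate_curve M (chord_envelope \<gamma> \<epsilon>) \<and>
         (\<forall>ue we. corresponds (chord_envelope \<gamma> \<epsilon>) ue we \<longleftrightarrow>
                   ue = corr_u (chord_envelope \<gamma> \<epsilon>) \<and> we = corr_w (chord_envelope \<gamma> \<epsilon>))"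
    and "expands2 (\<lambda>\<epsilon>. corr_u (chord_envelope \<gamma> \<epsilon>)) u (deriv w)"
    and "expands2 (\<lambda>\<epsilon>. corr_w (chord_envelope \<gamma> \<epsilon>)) w
           (\<lambda>x. - (u x * deriv u x) / 3 - (deriv ^^ 3) u x / 12)"
proof -
  obtain f v c where lc: "lifted_curve f u v (c *\<^sub>R M)" and c: "c \<noteq> 0" "\<And>x. f x \<in> Rep_rp2 (\<gamma> x)"
    and w: "w = (\<lambda>x. v x - vderiv u x / 2)"
    using nondegenerate_curve_lifted[OF assms] by blast
  interpret lifted_curve f u v "c *\<^sub>R M" by (rule lc)
  \<comment> \<open>Replaces the descriptions by explicit functions for all small \<epsilon>;
    everything below uses only these facts.\<close>
  have *: "\<forall>\<^sub>F \<epsilon> in at_right 0. (\<forall>\<delta>. is_envelope (chord \<gamma> \<epsilon>) \<delta> \<longleftrightarrow> \<delta> = chord_envelope \<gamma> \<epsilon>) \<and>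
      nondegenerate_curve M (chord_envelope \<gamma> \<epsilon>) \<and>
      corresponds (chord_envelope \<gamma> \<epsilon>) (u_env \<epsilon>) (w_env \<epsilon>)"
    using envelope_wronskian_pos
  proof eventually_elim
    case (elim \<epsilon>)
    note env = envelope_curve[OF assms(1) c(2) refl c(1) elim]
    have "chord_envelope \<gamma> \<epsilon> = (\<lambda>x. pt (envelope \<epsilon> x))"
      unfolding chord_envelope_def env(1) by simp
    thus ?case using env by simp
  qed
  show "\<forall>\<^sub>F \<epsilon> in at_right 0.
         (\<exists>!\<delta>. is_envelope (chord \<gamma> \<epsilon>) \<delta>) \<and>
         nondegenerate_curve M (chord_envelope \<gamma> \<epsilon>) \<and>
         (\<forall>ue we. corresponds (chord_envelope \<gamma> \<epsilon>) ue we \<longleftrightarrow>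
                   ue = corr_u (chord_envelope \<gamma> \<epsilon>) \<and> we = corr_w (chord_envelope \<gamma> \<epsilon>))"
    using *
  proof eventually_elim
    case (elim \<epsilon>)
    hence cor: "corresponds (chord_envelope \<gamma> \<epsilon>) (u_env \<epsilon>) (w_env \<epsilon>)" by blast
    have "corresponds (chord_envelope \<gamma> \<epsilon>) ue we \<longleftrightarrow> ue = u_env \<epsilon> \<and> we = w_env \<epsilon>" for ue we
      using cor corresponds_unique[OF _ cor] by blast
    thus ?case using elim corresponds_corr[OF cor] by auto
  qed
  note per = corresponds_periodic[OF assms(2)]
  have per1: "u1 (x + 1) = u1 x" "u2 (x + 1) = u2 x" "u3 (x + 1) = u3 x" for x
    by (intro vderiv_periodic per)+
  \<comment> \<open>Besides naming the coefficient, this makes \<open>u_tilde\<close> periodic, as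
    \<open>w\<close> is.\<close>
  have dw: "deriv w = u_tilde"
    by (rule ext) (simp add: deriv_eq_vderiv w u_tilde_def vderivs)
  have "vderiv w (x + 1) = vderiv w x" for x by (intro vderiv_periodic per)
  hence perw: "u_tilde (x + 1) = u_tilde x" for x by (simp flip: dw add: deriv_eq_vderiv)
  show "expands2 (\<lambda>\<epsilon>. corr_u (chord_envelope \<gamma> \<epsilon>)) u (deriv w)"
    unfolding dw
  proof (rule expands2I[OF u_env_expansion _ per(1) perw])
    show "\<forall>\<^sub>F \<epsilon> in at_right 0. corr_u (chord_envelope \<gamma> \<epsilon>) = u_env \<epsilon> \<and> (\<forall>x. u_env \<epsilon> (x + 1) = u_env \<epsilon> x)"
      using * by eventually_elim (use corresponds_corr(1) corresponds_periodic(1) in blast)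
  qed
  have wx: "v x - u1 x / 2 = w x" for x by (simp add: w)
  have du: "deriv u = u1" "(deriv ^^ 3) u = u3"
    by (simp_all add: deriv_eq_vderiv deriv_funpow_eq_vderiv vderiv_3)
  show "expands2 (\<lambda>\<epsilon>. corr_w (chord_envelope \<gamma> \<epsilon>)) w
           (\<lambda>x. - (u x * deriv u x) / 3 - (deriv ^^ 3) u x / 12)"
    unfolding du
  proof (rule expands2I[OF w_env_expansion[unfolded wx] _ per(2)])
    show "\<forall>\<^sub>F \<epsilon> in at_right 0. corr_w (chord_envelope \<gamma> \<epsilon>) = w_env \<epsilon> \<and> (\<forall>x. w_env \<epsilon> (x + 1) = w_env \<epsilon> x)"
      using * by eventually_elim (use corresponds_corr(2) corresponds_periodic(2) in blast)
  qed (simp add: per per1)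
qed

theorem theorem5:
  "(\<forall>M \<gamma> u w. nondegenerate_curve M \<gamma> \<and> corresponds \<gamma> u w \<longrightarrow>
      (\<forall>\<^sub>F \<epsilon> in at_right 0.
         (\<exists>!\<delta>. is_envelope (chord \<gamma> \<epsilon>) \<delta>) \<and>
         nondegenerate_curve M (chord_envelope \<gamma> \<epsilon>) \<and>
         (\<forall>ue we. corresponds (chord_envelope \<gamma> \<epsilon>) ue we \<longleftrightarrow>
                   ue = corr_u (chord_envelope \<gamma> \<epsilon>) \<and> we = corr_w (chord_envelope \<gamma> \<epsilon>))) \<and>
      expands2 (\<lambda>\<epsilon>. corr_u (chord_envelope \<gamma> \<epsilon>)) u (deriv w) \<and>
      expands2 (\<lambda>\<epsilon>. corr_w (chord_envelope \<gamma> \<epsilon>)) w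
        (\<lambda>x. - (u x * deriv u x) / 3 - (deriv ^^ 3) u x / 12)) \<and>
   (\<forall>I M \<gamma> u w. (\<forall>t\<in>I. nondegenerate_curve (M t) (\<gamma> t) \<and> corresponds (\<gamma> t) (u t) (w t)) \<longrightarrow>
      (continuous_limit_equation I \<gamma> u w \<longleftrightarrow>
       (\<forall>t\<in>I. \<forall>x.
          ((\<lambda>s. u s x) has_real_derivative deriv (w t) x) (at t within I) \<and>
          ((\<lambda>s. w s x) has_real_derivative
             - (u t x * deriv (u t) x) / 3 - (deriv ^^ 3) (u t) x / 12) (at t within I))))"
proof (intro conjI allI impI; (elim conjE)?)
  fix M \<gamma> u w assume "nondegenerate_curve M \<gamma>" "corresponds \<gamma> u w"
  note env = envelope_expansions[OF this]
  show "\<forall>\<^sub>F \<epsilon> in at_right 0.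
         (\<exists>!\<delta>. is_envelope (chord \<gamma> \<epsilon>) \<delta>) \<and>
         nondegenerate_curve M (chord_envelope \<gamma> \<epsilon>) \<and>
         (\<forall>ue we. corresponds (chord_envelope \<gamma> \<epsilon>) ue we \<longleftrightarrow>
                   ue = corr_u (chord_envelope \<gamma> \<epsilon>) \<and> we = corr_w (chord_envelope \<gamma> \<epsilon>))"
    "expands2 (\<lambda>\<epsilon>. corr_u (chord_envelope \<gamma> \<epsilon>)) u (deriv w)"
    "expands2 (\<lambda>\<epsilon>. corr_w (chord_envelope \<gamma> \<epsilon>)) w
        (\<lambda>x. - (u x * deriv u x) / 3 - (deriv ^^ 3) u x / 12)"
    by (rule env)+
next
  fix I :: "real set" and M :: "real \<Rightarrow> real^3^3" and \<gamma> and u w :: "real \<Rightarrow> real \<Rightarrow> real"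
  assume asm: "\<forall>t\<in>I. nondegenerate_curve (M t) (\<gamma> t) \<and> corresponds (\<gamma> t) (u t) (w t)"
  let ?W = "\<lambda>t x. - (u t x * deriv (u t) x) / 3 - (deriv ^^ 3) (u t) x / 12"
  \<comment> \<open>The expansions determine \<open>ut\<close> and \<open>wt\<close>, so the
    existential statement has a single instance. At a fixed \<open>t\<close> this is a statement
    about one curve; \<open>P\<close> will be the condition on the time derivatives.\<close>
  have *: "(\<exists>ut wt. expands2 (\<lambda>\<epsilon>. corr_u (chord_envelope (\<gamma> t) \<epsilon>)) (u t) ut \<and>
        expands2 (\<lambda>\<epsilon>. corr_w (chord_envelope (\<gamma> t) \<epsilon>)) (w t) wt \<and> P ut wt) \<longleftrightarrow> P (deriv (w t)) (?W t)"
    if "t \<in> I" for t P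
  proof -
    have "nondegenerate_curve (M t) (\<gamma> t)" "corresponds (\<gamma> t) (u t) (w t)" using asm that by auto
    note env = envelope_expansions(2,3)[OF this]
    show ?thesis using env expands2_unique[OF env(1)] expands2_unique[OF env(2)] by blast
  qed
  show "continuous_limit_equation I \<gamma> u w \<longleftrightarrow>
       (\<forall>t\<in>I. \<forall>x.
          ((\<lambda>s. u s x) has_real_derivative deriv (w t) x) (at t within I) \<and>
          ((\<lambda>s. w s x) has_real_derivative
             - (u t x * deriv (u t) x) / 3 - (deriv ^^ 3) (u t) x / 12) (at t within I))"
    unfolding continuous_limit_equation_def by (subst ball_cong[OF refl *]) (auto simp: all_conj_distrib)
qed

end
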